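(* Let $\ell(t)$ and $\tilde\ell(t)$, $t\in I$, be two fanning curves of $n$-dimensional subspaces of $\mathbb{R}^{kn}$. Then $\ell$ and $\tilde\ell$ are congruent if and only if, for any normal frames $A(t)$ spanning $\ell(t)$ and $B(t)$ spanning $\tilde\ell(t)$, there exists a constant invertible $n\times n$ matrix $X$ such that for all $t\in I$ $$\{B(t),t\}=X^{-1}\{A(t),t\}X \quad\text{and}\quad h_j[B(t),t]=X^{-1}h_j[A(t),t]X\quad (j=1,\dots,k-2).$$
   Context: Let $n\ge 1$, $k\ge 2$ be integers and $I\subset\mathbb{R}$ an interval containing $0$; all curves are smooth. A frame is a curve $A(t)$ of real $kn\times n$ matrices; it is fanning if the $kn\times kn$ matrix $(A(t)|\dot A(t)|\cdots|A^{(k-1)}(t))$ is invertible for all $t$. A frame spans the curve $\ell(t)$ in the Grassmannian $Gr(n,\mathbb{R}^{kn})$ if $\ell(t)$ is the column space of $A(t)$; $\ell(t)$ is fanning if a frame (equivalently, every frame) spanning it is fanning. A fanning frame satisfies, for unique smooth curves $P_1,\dots,P_k$ of $n\times n$ matrices, $A^{(k)}+\binom{k}{1}A^{(k-1)}P_1+\binom{k}{2}A^{(k-2)}P_2+\cdots+\binom{k}{k-1}\dot A P_{k-1}+AP_k=0$. The frame is normal if for every $t$ the columns of $A^{(k)}(t)$ are linear combinations of the columns of $A(t),\dot A(t),\dots,A^{(k-2)}(t)$ (i.e. $P_1\equiv 0$). The Schwarzian of $A$ is $\{A(t),t\}=2\,(P_2(t)-P_1(t)^2-\dot P_1(t))$.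 For $3\le j\le k$, $h_{j-2}[A(t),t]=X_A(t)^{-1}Q_j(t)X_A(t)$, where $X_A(t)\in GL(n)$ solves $\dot X_A=-X_AP_1$, $X_A(0)=I$, and $Q_j=\sum_{i=0}^{j}\binom{j}{i}\left(\frac{d^{j-i}}{dt^{j-i}}X_A\right)P_iX_A^{-1}$ with $P_0=I$. (For a normal frame, $\{A(t),t\}=2P_2$ and $h_{j-2}=P_j$.) Two curves $\ell,\tilde\ell$ in $Gr(n,\mathbb{R}^{kn})$ are congruent if there is $T\in GL(kn)$ with $T\ell(t)=\tilde\ell(t)$ for all $t$. *)

theory Defs
  imports "HOL-Analysis.Analysis"
begin

(* Curves are functions on the whole real line of which only the values on the interval I matter.
   Derivatives are taken within I, hence are one-sided at an endpoint that belongs to I. *)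

primrec nderiv :: "real set \<Rightarrow> nat \<Rightarrow> (real \<Rightarrow> 'a::real_normed_vector) \<Rightarrow> real \<Rightarrow> 'a" where
  "nderiv I 0 f = f"
| "nderiv I (Suc m) f = (\<lambda>t. vector_derivative (nderiv I m f) (at t within I))"

definition smooth_curve :: "real set \<Rightarrow> (real \<Rightarrow> 'a::real_normed_vector) \<Rightarrow> bool" where
  "smooth_curve I f \<longleftrightarrow> (\<forall>m. \<forall>t\<in>I. nderiv I m f differentiable (at t within I))"

(* Throughout, n is CARD('n), and the row index type 'm of a frame satisfies
   CARD('m) = k * CARD('n); this equation is a hypothesis of the theorem. *)

(* Which column of the kn x kn matrix is the q-th column of the p-th block. The choice of the
   enumeration permutes columns only, so it does not affect invertibility. *)
definition block_index :: "nat \<Rightarrow> 'm::finite \<Rightarrow> nat \<times> 'n::finite" where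
  "block_index k = (SOME e. bij_betw e UNIV ({..<k} \<times> UNIV))"

(* The matrix (A(t) | A'(t) | ... | A^(k-1)(t)). *)
definition jet_matrix ::
  "nat \<Rightarrow> real set \<Rightarrow> (real \<Rightarrow> real^'n^'m) \<Rightarrow> real \<Rightarrow> real^'m^'m" where
  "jet_matrix k I A t =
     (\<chi> i j. let (p, q) = (block_index k j :: nat \<times> 'n) in nderiv I p A t $ i $ q)"

definition fanning_frame :: "nat \<Rightarrow> real set \<Rightarrow> (real \<Rightarrow> real^'n^'m) \<Rightarrow> bool" where
  "fanning_frame k I A \<longleftrightarrow> smooth_curve I A \<and> (\<forall>t\<in>I. invertible (jet_matrix k I A t))"

definition spans_curve ::
  "real set \<Rightarrow> (real \<Rightarrow> real^'n^'m) \<Rightarrow> (real \<Rightarrow> (real^'m) set) \<Rightarrow> bool" where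
  "spans_curve I A l \<longleftrightarrow> (\<forall>t\<in>I. l t = span (columns (A t)))"

(* Smooth curves in the Grassmannian of CARD('n)-dimensional subspaces; a map into it is smooth
   iff it lifts locally to a smooth curve of matrices whose columns form a basis. *)
definition grassmann_curve ::
  "'n::finite itself \<Rightarrow> real set \<Rightarrow> (real \<Rightarrow> (real^'m) set) \<Rightarrow> bool" where
  "grassmann_curve _ I l \<longleftrightarrow>
     (\<forall>t\<in>I. subspace (l t) \<and> dim (l t) = CARD('n)) \<and>
     (\<forall>s\<in>I. \<exists>e>0. \<exists>A :: real \<Rightarrow> real^'n^'m.
        smooth_curve (I \<inter> ball s e) A \<and> spans_curve (I \<inter> ball s e) A l)"

definition fanning_curve ::
  "nat \<Rightarrow> 'n::finite itself \<Rightarrow> real set \<Rightarrow> (real \<Rightarrow> (real^'m) set) \<Rightarrow> bool" where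
  "fanning_curve k n I l \<longleftrightarrow> grassmann_curve n I l \<and>
     (\<exists>A :: real \<Rightarrow> real^'n^'m. fanning_frame k I A \<and> spans_curve I A l)"

definition normal_frame :: "nat \<Rightarrow> real set \<Rightarrow> (real \<Rightarrow> real^'n^'m) \<Rightarrow> bool" where
  "normal_frame k I A \<longleftrightarrow> fanning_frame k I A \<and>
     (\<forall>t\<in>I. columns (nderiv I k A t) \<subseteq> span (\<Union>i\<le>k - 2. columns (nderiv I i A t)))"

(* P 1, ..., P k are the coefficients of the differential equation satisfied by the frame A;
   P 0 is constantly the identity. *)
definition is_coeffs ::
  "nat \<Rightarrow> real set \<Rightarrow> (real \<Rightarrow> real^'n^'m) \<Rightarrow> (nat \<Rightarrow> real \<Rightarrow> real^'n^'n) \<Rightarrow> bool" where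
  "is_coeffs k I A P \<longleftrightarrow>
     P 0 = (\<lambda>t. mat 1) \<and> (\<forall>i\<in>{1..k}. smooth_curve I (P i)) \<and>
     (\<forall>t\<in>I. nderiv I k A t
             + (\<Sum>i=1..k. real (k choose i) *\<^sub>R (nderiv I (k - i) A t ** P i t)) = 0)"

(* For a fanning frame the values at t in I and i \<le> k are uniquely determined, and only these
   values enter below. *)
definition coeffs ::
  "nat \<Rightarrow> real set \<Rightarrow> (real \<Rightarrow> real^'n^'m) \<Rightarrow> nat \<Rightarrow> real \<Rightarrow> real^'n^'n" where
  "coeffs k I A = (SOME P. is_coeffs k I A P)"

definition schwarzian ::
  "nat \<Rightarrow> real set \<Rightarrow> (real \<Rightarrow> real^'n^'m) \<Rightarrow> real \<Rightarrow> real^'n^'n" where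
  "schwarzian k I A t =
     2 *\<^sub>R (coeffs k I A 2 t - coeffs k I A 1 t ** coeffs k I A 1 t
            - nderiv I 1 (coeffs k I A 1) t)"

(* X = X_A solves X' = - X P_1, X(0) = 1. For a fanning frame the solution exists and is unique
   on I, as for every linear equation. *)
definition is_gauge ::
  "nat \<Rightarrow> real set \<Rightarrow> (real \<Rightarrow> real^'n^'m) \<Rightarrow> (real \<Rightarrow> real^'n^'n) \<Rightarrow> bool" where
  "is_gauge k I A X \<longleftrightarrow> smooth_curve I X \<and> X 0 = mat 1 \<and>
     (\<forall>t\<in>I. invertible (X t) \<and>
            (X has_vector_derivative - (X t ** coeffs k I A 1 t)) (at t within I))"

definition gauge_sol ::
  "nat \<Rightarrow> real set \<Rightarrow> (real \<Rightarrow> real^'n^'m) \<Rightarrow> real \<Rightarrow> real^'n^'n" where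
  "gauge_sol k I A = (SOME X. is_gauge k I A X)"

definition Q_coeff ::
  "nat \<Rightarrow> real set \<Rightarrow> nat \<Rightarrow> (real \<Rightarrow> real^'n^'m) \<Rightarrow> real \<Rightarrow> real^'n^'n" where
  "Q_coeff k I j A t =
     (\<Sum>i=0..j. real (j choose i) *\<^sub>R
        (nderiv I (j - i) (gauge_sol k I A) t ** coeffs k I A i t
           ** matrix_inv (gauge_sol k I A t)))"

(* h_inv k I j is the invariant h_j, which is built from Q_(j+2); it is meaningful for
   1 \<le> j \<le> k - 2. *)
definition h_inv ::
  "nat \<Rightarrow> real set \<Rightarrow> nat \<Rightarrow> (real \<Rightarrow> real^'n^'m) \<Rightarrow> real \<Rightarrow> real^'n^'n" where
  "h_inv k I j A t =
     matrix_inv (gauge_sol k I A t) ** Q_coeff k I (j + 2) A t ** gauge_sol k I A t"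

definition congruent_curves ::
  "real set \<Rightarrow> (real \<Rightarrow> (real^'m) set) \<Rightarrow> (real \<Rightarrow> (real^'m) set) \<Rightarrow> bool" where
  "congruent_curves I l l' \<longleftrightarrow>
     (\<exists>T :: real^'m^'m. invertible T \<and> (\<forall>t\<in>I. (\<lambda>v. T *v v) ` l t = l' t))"

end

theory Submission
  imports Defs
begin

text \<open>
Why the theorem holds. A normal frame satisfies the linear equation
\<open>A^(k) + \<Sum>\<^sub>i (k choose i) A^(k-i) P\<^sub>i = 0\<close> with \<open>P\<^sub>1 = 0\<close>. Its gauge \<open>X\<^sub>A\<close> is therefore
constantly the identity, the Schwarzian is \<open>2 P\<^sub>2\<close> and \<open>h\<^sub>j\<close> is \<open>P\<^sub>j\<^sub>+\<^sub>2\<close>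
(\<open>schwarzian_normal\<close>, \<open>h_inv_normal\<close>). The theorem thus says that two curves are congruent iff
the coefficients of normal frames that span them are conjugate by one constant matrix.

Everything hinges on how \<open>P\<^sub>1\<close> changes under a change of frame: if \<open>B = A X\<close> then
\<open>X P\<^sub>1\<^sup>B = P\<^sub>1\<^sup>A X - X'\<close> (\<open>coeffs_1_right_mult\<close>). This has two consequences. Two normal frames of
the same curve differ by a constant matrix (\<open>normal_frame_ratio_constant\<close>), and any fanning frame
becomes normal after multiplication by an invertible solution of \<open>X' = P\<^sub>1 X\<close>
(\<open>normal_frame_exists\<close>).

If \<open>T\<close> carries the first curve to the second, then \<open>T A\<close> is a normal frame of the second curve
with the same coefficients as \<open>A\<close>, so \<open>B = T A X\<close> with \<open>X\<close> constant, and constant factors only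
conjugate the coefficients. Conversely, take normal frames \<open>A\<close> and \<open>B\<close>; if their coefficients are
conjugate by \<open>X\<close>, then \<open>A X\<close> and \<open>B\<close> solve the same equation. The matrix \<open>T\<close> that takes the jet
of \<open>A X\<close> to the jet of \<open>B\<close> is then independent of \<open>t\<close>
(\<open>equal_coeffs_imp_congruent_frames\<close>), and it is the required congruence.

Three tools are needed on the way: a calculus of smooth curves on an interval that includes products
and matrix inverses, the global solution of linear differential equations, and block matrices, which
turn statements about jets into statements about invertible square matrices.
\<close>

section \<open>Smooth curves on an interval\<close>

lemma bounded_bilinear_matrix_mult:
  "bounded_bilinear (\<lambda>(A::real^'n^'m) (B::real^'p^'n). A ** B)"
proof -
  have "bilinear (\<lambda>(A::real^'n^'m) (B::real^'p^'n). A ** B)"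
    unfolding bilinear_def linear_iff
    by (auto simp: vec_eq_iff matrix_matrix_mult_def algebra_simps sum.distrib sum_distrib_left)
  then show ?thesis
    by (simp add: bilinear_conv_bounded_bilinear)
qed

lemmas matrix_mult_has_vector_derivative =
  bounded_bilinear.has_vector_derivative[OF bounded_bilinear_matrix_mult]
lemmas matrix_mult_sum_left = bounded_bilinear.sum_left[OF bounded_bilinear_matrix_mult]
lemmas matrix_mult_sum_right = bounded_bilinear.sum_right[OF bounded_bilinear_matrix_mult]
lemmas matrix_mult_scaleR_left = bounded_bilinear.scaleR_left[OF bounded_bilinear_matrix_mult]
lemmas matrix_mult_scaleR_right = bounded_bilinear.scaleR_right[OF bounded_bilinear_matrix_mult]
lemmas matrix_mult_minus_left = bounded_bilinear.minus_left[OF bounded_bilinear_matrix_mult]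
lemmas matrix_mult_minus_right = bounded_bilinear.minus_right[OF bounded_bilinear_matrix_mult]
lemmas matrix_mult_diff_left = bounded_bilinear.diff_left[OF bounded_bilinear_matrix_mult]
lemmas matrix_mult_diff_right = bounded_bilinear.diff_right[OF bounded_bilinear_matrix_mult]
lemmas matrix_mult_zero_left = bounded_bilinear.zero_left[OF bounded_bilinear_matrix_mult]
lemmas matrix_mult_zero_right = bounded_bilinear.zero_right[OF bounded_bilinear_matrix_mult]
lemmas matrix_mult_add_left = bounded_bilinear.add_left[OF bounded_bilinear_matrix_mult]
lemmas matrix_mult_add_right = bounded_bilinear.add_right[OF bounded_bilinear_matrix_mult]

lemma
  fixes A :: "real^'n^'n"
  assumes "invertible A"
  shows matrix_inv_right: "A ** matrix_inv A = mat 1"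
    and matrix_inv_left: "matrix_inv A ** A = mat 1"
  using someI_ex[OF assms[unfolded invertible_def]] by (simp_all add: matrix_inv_def)

locale curve_domain =
  fixes I :: "real set"
  assumes interval: "is_interval I" and nondegenerate: "interior I \<noteq> {}"
begin

text \<open>One-sided derivatives at the points of \<open>I\<close> are unique because no point of \<open>I\<close> is isolated.
This is what makes \<^const>\<open>nderiv\<close> computable.\<close>

lemma at_within_nontrivial: "t \<in> I \<Longrightarrow> at t within I \<noteq> bot"
proof -
  assume t: "t \<in> I"
  have "I \<noteq> {x}" for x using nondegenerate by auto
  then have "t islimpt I"
    using connected_imp_perfect[OF is_interval_connected[OF interval] t] by blast
  then show ?thesis by (simp add: trivial_limit_within)
qed

lemma nderiv_has_vector_derivative:
  assumes "smooth_curve I f" "t \<in> I"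
  shows "(nderiv I m f has_vector_derivative nderiv I (Suc m) f t) (at t within I)"
  using assms by (simp add: smooth_curve_def vector_derivative_works)

lemma smooth_curve_has_derivative:
  "smooth_curve I f \<Longrightarrow> t \<in> I \<Longrightarrow> (f has_vector_derivative nderiv I 1 f t) (at t within I)"
  using nderiv_has_vector_derivative[of f t 0] by simp

text \<open>The next two lemmas replace the recursion through \<^const>\<open>vector_derivative\<close> by any explicit
sequence of successive derivatives. Most closure properties follow by writing down such a sequence.\<close>

lemma nderiv_eq_derivative_sequence:
  assumes g0: "\<And>t. t \<in> I \<Longrightarrow> g 0 t = f t"
    and g: "\<And>m t. t \<in> I \<Longrightarrow> (g m has_vector_derivative g (Suc m) t) (at t within I)"
    and t: "t \<in> I"
  shows "nderiv I m f t = g m t"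
  using t
proof (induction m arbitrary: t)
  case (Suc m)
  have "(nderiv I m f has_vector_derivative g (Suc m) t) (at t within I)"
    by (rule has_vector_derivative_transform[OF Suc.prems Suc.IH g[OF Suc.prems]])
  then show ?case
    using at_within_nontrivial[OF Suc.prems] by (simp add: vector_derivative_within)
qed (simp add: g0)

lemma smooth_curve_derivative_sequence:
  assumes g0: "\<And>t. t \<in> I \<Longrightarrow> g 0 t = f t"
    and g: "\<And>m t. t \<in> I \<Longrightarrow> (g m has_vector_derivative g (Suc m) t) (at t within I)"
  shows "smooth_curve I f"
  unfolding smooth_curve_def
proof (intro allI ballI)
  fix m t assume t: "t \<in> I"
  have "(nderiv I m f has_vector_derivative g (Suc m) t) (at t within I)"
    by (rule has_vector_derivative_transform[OF t _ g[OF t]])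
      (rule nderiv_eq_derivative_sequence[OF g0 g])
  then show "nderiv I m f differentiable (at t within I)"
    by (rule differentiableI_vector)
qed

lemma smooth_curve_cong:
  assumes "smooth_curve I f" "\<And>t. t \<in> I \<Longrightarrow> f t = g t"
  shows "smooth_curve I g"
  by (rule smooth_curve_derivative_sequence[of "\<lambda>m. nderiv I m f"])
    (use assms nderiv_has_vector_derivative in auto)

lemma nderiv_cong:
  assumes "smooth_curve I f" "\<And>t. t \<in> I \<Longrightarrow> f t = g t" "t \<in> I"
  shows "nderiv I m g t = nderiv I m f t"
  by (rule nderiv_eq_derivative_sequence[of "\<lambda>m. nderiv I m f"])
    (use assms nderiv_has_vector_derivative in auto)

text \<open>Where the higher derivatives have no convenient closed form, it is enough to find a set of
curves that is closed under differentiation.\<close>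

lemma smooth_curve_coinduct:
  assumes f: "f \<in> S"
    and S: "\<And>f. f \<in> S \<Longrightarrow> \<exists>g\<in>S. \<forall>t\<in>I. (f has_vector_derivative g t) (at t within I)"
  shows "smooth_curve I f"
proof -
  obtain d where d: "\<And>f. f \<in> S \<Longrightarrow> d f \<in> S"
    "\<And>f t. f \<in> S \<Longrightarrow> t \<in> I \<Longrightarrow> (f has_vector_derivative d f t) (at t within I)"
    using S by metis
  have mem: "(d ^^ m) f \<in> S" for m
    by (induction m) (auto simp: f d)
  show ?thesis
    by (rule smooth_curve_derivative_sequence[of "\<lambda>m. (d ^^ m) f"]) (use d mem in auto)
qed

lemma smooth_curve_nderiv:
  assumes "smooth_curve I f"
  shows "smooth_curve I (nderiv I m f)"
  by (rule smooth_curve_coinduct[of _ "range (\<lambda>m. nderiv I m f)"])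
    (use nderiv_has_vector_derivative[OF assms] in blast)+

lemma smooth_curve_const: "smooth_curve I (\<lambda>t. c)"
  by (rule smooth_curve_coinduct[of _ "range (\<lambda>c t. c)"])
    (auto intro!: has_vector_derivative_const)

lemma nderiv_const: "t \<in> I \<Longrightarrow> nderiv I m (\<lambda>t. c) t = (if m = 0 then c else 0)"
  by (rule nderiv_eq_derivative_sequence[of "\<lambda>m t. if m = 0 then c else 0"])
    (auto intro!: has_vector_derivative_const)

lemma
  assumes h: "bounded_linear h" and f: "smooth_curve I f"
  shows smooth_curve_linear: "smooth_curve I (\<lambda>t. h (f t))"
    and nderiv_linear: "t \<in> I \<Longrightarrow> nderiv I m (\<lambda>t. h (f t)) t = h (nderiv I m f t)"
proof -
  have *: "((\<lambda>t. h (nderiv I m f t)) has_vector_derivative h (nderiv I (Suc m) f t)) (at t within I)"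
    if "t \<in> I" for m t
    by (rule bounded_linear.has_vector_derivative[OF h nderiv_has_vector_derivative[OF f that]])
  show "smooth_curve I (\<lambda>t. h (f t))"
    by (rule smooth_curve_derivative_sequence[of "\<lambda>m t. h (nderiv I m f t)"]) (use * in auto)
  show "t \<in> I \<Longrightarrow> nderiv I m (\<lambda>t. h (f t)) t = h (nderiv I m f t)"
    by (rule nderiv_eq_derivative_sequence[of "\<lambda>m t. h (nderiv I m f t)"]) (use * in auto)
qed

lemma smooth_curve_add:
  assumes "smooth_curve I f" "smooth_curve I g"
  shows "smooth_curve I (\<lambda>t. f t + g t)"
  by (rule smooth_curve_derivative_sequence[of "\<lambda>m t. nderiv I m f t + nderiv I m g t"])
    (use assms nderiv_has_vector_derivative in \<open>auto intro!: has_vector_derivative_add\<close>)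

lemma smooth_curve_sum:
  assumes "\<And>i. i \<in> S \<Longrightarrow> smooth_curve I (f i)"
  shows "smooth_curve I (\<lambda>t. \<Sum>i\<in>S. f i t)"
  using assms
  by (induction S rule: infinite_finite_induct)
    (simp_all add: smooth_curve_const smooth_curve_add)

text \<open>Pascal's rule makes the Leibniz sums a sequence of successive derivatives.\<close>

lemma has_vector_derivative_Leibniz_sum:
  fixes prod (infixl "\<bullet>\<bullet>" 70)
  assumes pr: "bounded_bilinear (\<bullet>\<bullet>)" and f: "smooth_curve I f" and g: "smooth_curve I g"
    and t: "t \<in> I"
  defines "L \<equiv> \<lambda>m t. \<Sum>i\<le>m. real (m choose i) *\<^sub>R (nderiv I (m - i) f t \<bullet>\<bullet> nderiv I i g t)"
  shows "(L m has_vector_derivative L (Suc m) t) (at t within I)"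
proof -
  interpret bounded_bilinear "(\<bullet>\<bullet>)" by fact
  define F where "F i j = nderiv I i f t \<bullet>\<bullet> nderiv I j g t" for i j
  have "(L m has_vector_derivative
      (\<Sum>i\<le>m. real (m choose i) *\<^sub>R (F (m - i) (Suc i) + F (Suc (m - i)) i))) (at t within I)"
    unfolding L_def F_def
    by (intro has_vector_derivative_sum bounded_linear.has_vector_derivative[OF bounded_linear_scaleR_right]
        has_vector_derivative nderiv_has_vector_derivative f g t)
  also have "(\<Sum>i\<le>m. real (m choose i) *\<^sub>R (F (m - i) (Suc i) + F (Suc (m - i)) i)) =
      (\<Sum>i\<le>m. real (m choose i) *\<^sub>R F (m - i) (Suc i)) + (\<Sum>i\<le>m. real (m choose i) *\<^sub>R F (Suc m - i) i)"
    by (simp add: scaleR_add_right sum.distrib Suc_diff_le)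
  also have "(\<Sum>i\<le>m. real (m choose i) *\<^sub>R F (Suc m - i) i) =
      (\<Sum>i\<le>Suc m. real (m choose i) *\<^sub>R F (Suc m - i) i)"
    by simp
  also have "\<dots> = F (Suc m) 0 + (\<Sum>i\<le>m. real (m choose Suc i) *\<^sub>R F (m - i) (Suc i))"
    by (subst sum.atMost_Suc_shift) simp
  also have "(\<Sum>i\<le>m. real (m choose i) *\<^sub>R F (m - i) (Suc i)) +
      (F (Suc m) 0 + (\<Sum>i\<le>m. real (m choose Suc i) *\<^sub>R F (m - i) (Suc i))) =
      F (Suc m) 0 + (\<Sum>i\<le>m. real (Suc m choose Suc i) *\<^sub>R F (m - i) (Suc i))"
    by (simp add: scaleR_add_left sum.distrib)
  also have "\<dots> = L (Suc m) t"
    unfolding L_def F_def by (subst sum.atMost_Suc_shift) simp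
  finally show ?thesis .
qed

lemma
  fixes prod (infixl "\<bullet>\<bullet>" 70)
  assumes pr: "bounded_bilinear (\<bullet>\<bullet>)" and f: "smooth_curve I f" and g: "smooth_curve I g"
  shows smooth_curve_bilinear: "smooth_curve I (\<lambda>t. f t \<bullet>\<bullet> g t)"
    and nderiv_bilinear: "t \<in> I \<Longrightarrow> nderiv I m (\<lambda>t. f t \<bullet>\<bullet> g t) t =
      (\<Sum>i\<le>m. real (m choose i) *\<^sub>R (nderiv I (m - i) f t \<bullet>\<bullet> nderiv I i g t))"
proof -
  let ?L = "\<lambda>m t. \<Sum>i\<le>m. real (m choose i) *\<^sub>R (nderiv I (m - i) f t \<bullet>\<bullet> nderiv I i g t)"
  note * = has_vector_derivative_Leibniz_sum[OF pr f g]
  show "smooth_curve I (\<lambda>t. f t \<bullet>\<bullet> g t)"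
    by (rule smooth_curve_derivative_sequence[of ?L]) (use * in auto)
  show "t \<in> I \<Longrightarrow> nderiv I m (\<lambda>t. f t \<bullet>\<bullet> g t) t = ?L m t"
    by (rule nderiv_eq_derivative_sequence[of ?L]) (use * in auto)
qed

lemmas smooth_curve_matrix_mult = smooth_curve_bilinear[OF bounded_bilinear_matrix_mult]
lemmas nderiv_matrix_mult = nderiv_bilinear[OF bounded_bilinear_matrix_mult]
lemmas smooth_curve_mult = smooth_curve_bilinear[OF bounded_bilinear_mult]

lemma smooth_curve_prod:
  fixes f :: "'i \<Rightarrow> real \<Rightarrow> real"
  assumes "\<And>i. i \<in> S \<Longrightarrow> smooth_curve I (f i)"
  shows "smooth_curve I (\<lambda>t. \<Prod>i\<in>S. f i t)"
  using assms
  by (induction S rule: infinite_finite_induct)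
    (simp_all add: smooth_curve_const smooth_curve_mult)

text \<open>The curves \<open>p / f\<^sup>m\<close> with \<open>p\<close> smooth are closed under differentiation.\<close>

lemma smooth_curve_inverse:
  fixes f :: "real \<Rightarrow> real"
  assumes f: "smooth_curve I f" and nz: "\<And>t. t \<in> I \<Longrightarrow> f t \<noteq> 0"
  shows "smooth_curve I (\<lambda>t. inverse (f t))"
proof (rule smooth_curve_coinduct)
  let ?S = "{\<lambda>t. p t * inverse (f t) ^ m | p m. smooth_curve I p}"
  show "(\<lambda>t. inverse (f t)) \<in> ?S"
    by (intro CollectI exI[of _ "\<lambda>_. 1"] exI[of _ 1]) (simp add: smooth_curve_const)
  fix h assume "h \<in> ?S"
  then obtain p m where h: "h = (\<lambda>t. p t * inverse (f t) ^ m)" and p: "smooth_curve I p"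
    by auto
  define q where "q t = nderiv I 1 p t * f t + (- real m) * (p t * nderiv I 1 f t)" for t
  have q: "smooth_curve I q"
    unfolding q_def
    by (intro smooth_curve_add smooth_curve_mult smooth_curve_nderiv smooth_curve_const p f)
  have "(h has_vector_derivative q t * inverse (f t) ^ Suc m) (at t within I)" if t: "t \<in> I" for t
  proof -
    have pd: "(p has_real_derivative nderiv I 1 p t) (at t within I)"
      and fd: "(f has_real_derivative nderiv I 1 f t) (at t within I)"
      using smooth_curve_has_derivative[OF p t] smooth_curve_has_derivative[OF f t]
      by (simp_all add: has_real_derivative_iff_has_vector_derivative)
    have "(h has_real_derivative q t * inverse (f t) ^ Suc m) (at t within I)"
      unfolding h
      apply (rule derivative_eq_intros pd fd nz t refl)+
      using nz[OF t] by (cases m) (simp_all add: q_def field_simps)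
    then show ?thesis by (simp add: has_real_derivative_iff_has_vector_derivative)
  qed
  then show "\<exists>g\<in>?S. \<forall>t\<in>I. (h has_vector_derivative g t) (at t within I)"
    using q by (intro bexI[of _ "\<lambda>t. q t * inverse (f t) ^ Suc m"]) (auto simp del: power_Suc)
qed

lemma smooth_curve_matrix_component:
  fixes F :: "real \<Rightarrow> real^'n^'m"
  shows "smooth_curve I F \<Longrightarrow> smooth_curve I (\<lambda>t. F t $ i $ j)"
  by (intro smooth_curve_linear[where h = "\<lambda>F. F $ i $ j"]
      bounded_linear_compose[OF bounded_linear_vec_nth bounded_linear_vec_nth])

lemma smooth_curve_matrixI:
  fixes F :: "real \<Rightarrow> real^'n^'m"
  assumes "\<And>i j. smooth_curve I (\<lambda>t. F t $ i $ j)"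
  shows "smooth_curve I F"
proof -
  have "smooth_curve I (\<lambda>t. \<Sum>i\<in>UNIV. \<Sum>j\<in>UNIV. F t $ i $ j *\<^sub>R (axis i (axis j 1) :: real^'n^'m))"
    by (intro smooth_curve_sum smooth_curve_bilinear[OF bounded_bilinear_scaleR]
        smooth_curve_const assms)
  moreover have "(\<Sum>i\<in>UNIV. \<Sum>j\<in>UNIV. X $ i $ j *\<^sub>R (axis i (axis j 1) :: real^'n^'m)) = X" for X
  proof -
    have "(\<Sum>i\<in>UNIV. \<Sum>j\<in>UNIV. X $ i $ j *\<^sub>R (axis i (axis j 1) :: real^'n^'m)) $ p $ q = X $ p $ q" for p q
    proof -
      have "X $ i $ j * (axis i (axis j 1) :: real^'n^'m) $ p $ q =
          (if j = q then if i = p then X $ i $ j else 0 else 0)" for i j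
        by (simp add: axis_def)
      then show ?thesis by (simp add: sum.delta)
    qed
    then show ?thesis by (simp add: vec_eq_iff)
  qed
  ultimately show ?thesis by simp
qed

lemma smooth_curve_det:
  fixes F :: "real \<Rightarrow> real^'n^'n"
  assumes "smooth_curve I F"
  shows "smooth_curve I (\<lambda>t. det (F t))"
  unfolding det_def
  by (intro smooth_curve_sum smooth_curve_mult smooth_curve_const smooth_curve_prod
      smooth_curve_matrix_component assms)

text \<open>By Cramer's rule the entries of the inverse are quotients of determinants.\<close>

lemma smooth_curve_matrix_inv:
  fixes J :: "real \<Rightarrow> real^'n^'n"
  assumes J: "smooth_curve I J" and inv: "\<And>t. t \<in> I \<Longrightarrow> invertible (J t)"
  shows "smooth_curve I (\<lambda>t. matrix_inv (J t))"
proof (rule smooth_curve_matrixI)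
  fix p q
  let ?C = "\<lambda>t. \<chi> i j. if j = p then (axis q 1 :: real^'n) $ i else J t $ i $ j"
  have C: "smooth_curve I ?C"
  proof (rule smooth_curve_matrixI)
    fix i j show "smooth_curve I (\<lambda>t. ?C t $ i $ j)"
      by (cases "j = p") (simp_all add: smooth_curve_const smooth_curve_matrix_component J)
  qed
  have "det (?C t) * inverse (det (J t)) = matrix_inv (J t) $ p $ q" if t: "t \<in> I" for t
  proof -
    have d: "det (J t) \<noteq> 0" using inv[OF t] by (simp add: invertible_det_nz)
    have "J t *v (matrix_inv (J t) *v axis q 1) = axis q 1"
      by (simp add: matrix_vector_mul_assoc matrix_inv_right inv t)
    then have "matrix_inv (J t) *v axis q 1 =
        (\<chi> k. det (\<chi> i j. if j = k then (axis q 1 :: real^'n) $ i else J t $ i $ j) / det (J t))"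
      using cramer[OF d] by blast
    then have "(matrix_inv (J t) *v axis q 1) $ p = det (?C t) / det (J t)"
      by simp
    then show ?thesis
      by (simp add: matrix_vector_mult_basis column_def divide_inverse)
  qed
  moreover have "smooth_curve I (\<lambda>t. det (?C t) * inverse (det (J t)))"
    by (intro smooth_curve_mult smooth_curve_inverse smooth_curve_det C J)
      (use inv in \<open>simp add: invertible_det_nz\<close>)
  ultimately show "smooth_curve I (\<lambda>t. matrix_inv (J t) $ p $ q)"
    by (rule smooth_curve_cong[rotated])
qed

end

section \<open>Linear differential equations\<close>

text \<open>An arbitrary interval need not be compact, and its coefficients need not be bounded. Derivatives
within it are local, however, so they may be computed in a compact subinterval that contains \<open>t\<close>
and the initial time \<open>0\<close> and is a neighbourhood of \<open>t\<close> relative to the interval.\<close>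

lemma interval_compact_neighbourhood:
  fixes I :: "real set"
  assumes I: "is_interval I" and "0 \<in> I" "t \<in> I"
  obtains a b where "{a..b} \<subseteq> I" "0 \<in> {a..b}" "t \<in> {a..b}" "at t within I = at t within {a..b}"
proof -
  \<comment> \<open>The window \<open>]lo, hi[\<close> around \<open>t\<close> leaves the interval only on a side where \<open>t\<close> is its endpoint.\<close>
  obtain lo where lo: "lo < t" "I \<inter> {lo<..<t} = {} \<or> lo \<in> I"
    by (cases "\<exists>s\<in>I. s < t") (auto intro: that[of "t - 1"])
  obtain hi where hi: "t < hi" "I \<inter> {t<..<hi} = {} \<or> hi \<in> I"
    by (cases "\<exists>s\<in>I. t < s") (auto intro: that[of "t + 1"])
  define a where "a = (if lo \<in> I then min 0 lo else min 0 t)"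
  define b where "b = (if hi \<in> I then max 0 hi else max 0 t)"
  have "a \<in> I" "b \<in> I" using assms by (auto simp: a_def b_def min_def max_def)
  then have sub: "{a..b} \<subseteq> I"
    using I unfolding is_interval_1 by (meson atLeastAtMost_iff subsetI)
  have "at t within I = at t within {a..b}"
  proof (rule at_within_nhd[of _ "{lo<..<hi}"])
    show "I \<inter> {lo<..<hi} - {t} = {a..b} \<inter> {lo<..<hi} - {t}"
    proof (intro equalityI subsetI)
      fix s assume s: "s \<in> I \<inter> {lo<..<hi} - {t}"
      then have "s < t \<Longrightarrow> lo \<in> I" "s > t \<Longrightarrow> hi \<in> I" using lo hi by auto
      then show "s \<in> {a..b} \<inter> {lo<..<hi} - {t}"
        using s by (cases "s < t") (auto simp: a_def b_def)
    qed (use sub in auto)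
  qed (use lo hi in auto)
  moreover have "0 \<in> {a..b}" "t \<in> {a..b}" using lo hi by (auto simp: a_def b_def)
  ultimately show ?thesis using that sub by blast
qed

text \<open>The oriented integral: one of the two terms vanishes, whichever sign \<open>t\<close> has.\<close>

definition integral_from_0 :: "(real \<Rightarrow> 'a::banach) \<Rightarrow> real \<Rightarrow> 'a" where
  "integral_from_0 f t = integral {0..t} f - integral {t..0} f"

lemma integral_from_0_at_0: "integral_from_0 f 0 = 0"
  by (simp add: integral_from_0_def)

lemma integral_from_0_has_vector_derivative:
  fixes f :: "real \<Rightarrow> 'a::banach"
  assumes I: "is_interval I" "0 \<in> I" and f: "continuous_on I f" and t: "t \<in> I"
  shows "(integral_from_0 f has_vector_derivative f t) (at t within I)"
proof -
  obtain a b where ab: "{a..b} \<subseteq> I" "0 \<in> {a..b}" "t \<in> {a..b}" "at t within I = at t within {a..b}"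
    using interval_compact_neighbourhood[OF I t] .
  have fc: "continuous_on {a..b} f" using f ab(1) continuous_on_subset by blast
  have *: "integral_from_0 f u = integral {a..u} f - integral {a..0} f" if "u \<in> {a..b}" for u
  proof (cases "u \<ge> 0")
    case True
    have "integral {a..0} f + integral {0..u} f = integral {a..u} f"
      by (rule Henstock_Kurzweil_Integration.integral_combine)
        (use that ab True in \<open>auto intro!: integrable_continuous_real continuous_on_subset[OF fc]\<close>)
    then show ?thesis using True
      by (cases "u = 0") (auto simp: integral_from_0_def algebra_simps)
  next
    case False
    have "integral {a..u} f + integral {u..0} f = integral {a..0} f"
      by (rule Henstock_Kurzweil_Integration.integral_combine)
        (use that ab False in \<open>auto intro!: integrable_continuous_real continuous_on_subset[OF fc]\<close>)
    then show ?thesis using False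
      by (auto simp: integral_from_0_def algebra_simps)
  qed
  have "((\<lambda>u. integral {a..u} f - integral {a..0} f) has_vector_derivative f t - 0) (at t within {a..b})"
    by (intro has_vector_derivative_diff integral_has_vector_derivative fc ab has_vector_derivative_const)
  then have "(integral_from_0 f has_vector_derivative f t) (at t within {a..b})"
    using has_vector_derivative_transform[OF ab(3) *] by simp
  then show ?thesis using ab by simp
qed

text \<open>The inductive step of the bound on Picard iterates. Running along \<open>u \<mapsto> u t\<close> for
\<open>u \<in> [0, 1]\<close> treats both signs of \<open>t\<close> at once.\<close>

lemma norm_le_power_Suc:
  fixes F :: "real \<Rightarrow> 'a::real_normed_vector"
  assumes J: "is_interval J" "0 \<in> J" "t \<in> J" and F0: "F 0 = 0"
    and F: "\<And>s. s \<in> J \<Longrightarrow> (F has_vector_derivative f s) (at s within J)"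
    and bound: "\<And>s. s \<in> J \<Longrightarrow> norm (f s) \<le> K * \<bar>s\<bar> ^ m"
  shows "norm (F t) \<le> K * \<bar>t\<bar> ^ Suc m / real (Suc m)"
proof -
  have mem: "u * t \<in> J" if "u \<in> {0..1}" for u
    using convexD[OF is_interval_convex[OF J(1)] J(2,3), of "1 - u" u] that by simp
  let ?h = "F \<circ> (\<lambda>u. u * t)"
  have h: "(?h has_vector_derivative t *\<^sub>R f (u * t)) (at u within {0..1})" if "u \<in> {0..1}" for u
  proof (rule vector_diff_chain_within)
    show "((\<lambda>u. u * t) has_vector_derivative t) (at u within {0..1})"
      by (auto intro!: derivative_eq_intros simp: has_real_derivative_iff_has_vector_derivative[symmetric])
    show "(F has_vector_derivative f (u * t)) (at (u * t) within (\<lambda>u. u * t) ` {0..1})"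
      by (rule has_vector_derivative_within_subset[OF F]) (use mem that in auto)
  qed
  let ?\<phi> = "\<lambda>u. K * \<bar>t\<bar> ^ Suc m * (u ^ Suc m / real (Suc m))"
  have "norm (?h 1 - ?h 0) \<le> ?\<phi> 1 - ?\<phi> 0"
  proof (rule differentiable_bound_general)
    show "continuous_on {0..1} ?h"
      using h by (intro continuous_on_vector_derivative)
    show "continuous_on {0..1} ?\<phi>" by (intro continuous_intros) auto
  next
    fix u :: real assume u: "0 < u" "u < 1"
    show "(?h has_vector_derivative t *\<^sub>R f (u * t)) (at u)"
      using h[of u] u by (simp add: at_within_Icc_at)
    have "((\<lambda>u. u ^ Suc m / real (Suc m)) has_real_derivative u ^ m) (at u)"
      by (auto intro!: derivative_eq_intros simp del: power_Suc of_nat_Suc)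
    then show "(?\<phi> has_vector_derivative K * \<bar>t\<bar> ^ Suc m * u ^ m) (at u)"
      by (intro has_vector_derivative_mult_right)
        (simp add: has_real_derivative_iff_has_vector_derivative)
    have "\<bar>t\<bar> * norm (f (u * t)) \<le> \<bar>t\<bar> * (K * \<bar>u * t\<bar> ^ m)"
      by (intro mult_left_mono bound mem) (use u in auto)
    then show "norm (t *\<^sub>R f (u * t)) \<le> K * \<bar>t\<bar> ^ Suc m * u ^ m"
      using u by (simp add: abs_mult power_mult_distrib mult_ac)
  qed simp
  then show ?thesis by (simp add: F0)
qed

text \<open>The Picard iterates \<open>\<Phi>\<^sub>m\<close>, each the integral of \<open>L\<close> applied to the one before, are bounded on
compact subintervals by the terms of an exponential series. Hence their sum converges, may be
differentiated termwise, and solves the equation on the whole interval.\<close>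

lemma linear_ode_solution_exists:
  fixes L :: "real \<Rightarrow> 'a::banach \<Rightarrow>\<^sub>L 'a"
  assumes I: "is_interval I" "0 \<in> I" and L: "continuous_on I L"
  shows "\<exists>x. x 0 = x0 \<and> (\<forall>t\<in>I. (x has_vector_derivative L t (x t)) (at t within I))"
proof -
  define \<Phi> where "\<Phi> = rec_nat (\<lambda>_. x0) (\<lambda>_ g. integral_from_0 (\<lambda>t. L t (g t)))"
  have \<Phi>_0: "\<Phi> 0 = (\<lambda>_. x0)"
    and \<Phi>_Suc: "\<Phi> (Suc m) = integral_from_0 (\<lambda>t. L t (\<Phi> m t))" for m
    by (simp_all add: \<Phi>_def)
  have d_Suc: "(\<Phi> (Suc m) has_vector_derivative L t (\<Phi> m t)) (at t within I)"
    if "continuous_on I (\<Phi> m)" "t \<in> I" for m t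
    unfolding \<Phi>_Suc
    by (intro integral_from_0_has_vector_derivative I that continuous_intros L)
  have cont: "continuous_on I (\<Phi> m)" for m
  proof (induction m)
    case (Suc m)
    then show ?case using d_Suc by (intro continuous_on_vector_derivative)
  qed (simp add: \<Phi>_0)
  note d_Suc = d_Suc[OF cont]
  have \<Phi>_at_0: "\<Phi> m 0 = (if m = 0 then x0 else 0)" for m
    by (cases m) (simp_all add: \<Phi>_0 \<Phi>_Suc integral_from_0_at_0)
  define x where "x t = (\<Sum>m. \<Phi> m t)" for t
  have "(x has_vector_derivative L t (x t)) (at t within I)" if t: "t \<in> I" for t
  proof -
    obtain a b where ab: "{a..b} \<subseteq> I" "0 \<in> {a..b}" "t \<in> {a..b}" "at t within I = at t within {a..b}"
      using interval_compact_neighbourhood[OF I t] .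
    let ?J = "{a..b}"
    have "bounded (L ` ?J)"
      using L ab(1) by (intro compact_imp_bounded compact_continuous_image) (auto intro: continuous_on_subset)
    then obtain C where C: "C > 0" "\<And>s. s \<in> ?J \<Longrightarrow> norm (L s) \<le> C"
      unfolding bounded_pos by auto
    have dJ: "(\<Phi> (Suc m) has_vector_derivative L s (\<Phi> m s)) (at s within ?J)" if "s \<in> ?J" for m s
      using d_Suc ab(1) that has_vector_derivative_within_subset by (meson subsetD)
    have bound: "norm (\<Phi> m s) \<le> norm x0 * C ^ m / fact m * \<bar>s\<bar> ^ m" if "s \<in> ?J" for m s
      using that
    proof (induction m arbitrary: s)
      case (Suc m)
      have "norm (\<Phi> (Suc m) s) \<le> C * (norm x0 * C ^ m / fact m) * \<bar>s\<bar> ^ Suc m / real (Suc m)"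
      proof (rule norm_le_power_Suc[OF _ ab(2) Suc.prems _ dJ])
        fix u assume u: "u \<in> ?J"
        have "norm (L u (\<Phi> m u)) \<le> norm (L u) * norm (\<Phi> m u)" by (rule norm_blinfun)
        also have "\<dots> \<le> C * (norm x0 * C ^ m / fact m * \<bar>u\<bar> ^ m)"
          by (intro mult_mono C Suc.IH u) (use C in auto)
        finally show "norm (L u (\<Phi> m u)) \<le> C * (norm x0 * C ^ m / fact m) * \<bar>u\<bar> ^ m"
          by (simp add: mult_ac)
      qed (simp_all add: \<Phi>_at_0)
      then show ?case by (simp add: field_simps)
    qed (simp add: \<Phi>_0)
    define R where "R = max \<bar>a\<bar> \<bar>b\<bar>"
    define B where "B m = norm x0 * ((C * R) ^ m / fact m)" for m
    have B: "norm (\<Phi> m s) \<le> B m" if "s \<in> ?J" for m s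
    proof -
      have "\<bar>s\<bar> ^ m \<le> R ^ m" by (rule power_mono) (use that in \<open>auto simp: R_def\<close>)
      then have "norm x0 * C ^ m / fact m * \<bar>s\<bar> ^ m \<le> norm x0 * C ^ m / fact m * R ^ m"
        using C by (intro mult_left_mono) auto
      with bound[OF that, of m] show ?thesis by (simp add: B_def power_mult_distrib)
    qed
    have sB: "summable B"
      unfolding B_def using summable_exp[of "C * R"]
      by (intro summable_mult) (simp add: field_simps)
    have sums: "summable (\<lambda>m. \<Phi> m s)" if "s \<in> ?J" for s
      by (rule summable_comparison_test'[OF sB]) (use B that in auto)
    \<comment> \<open>The derivative of the \<open>m\<close>-th term: zero for the constant \<open>\<Phi> 0\<close>.\<close>
    define \<Psi> where "\<Psi> m s = (case m of 0 \<Rightarrow> 0 | Suc m \<Rightarrow> L s (\<Phi> m s))" for m s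
    have unif: "uniform_limit ?J (\<lambda>n s. \<Sum>m<n. \<Psi> m s) (\<lambda>s. \<Sum>m. \<Psi> m s) sequentially"
    proof (rule Weierstrass_m_test)
      show "norm (\<Psi> m s) \<le> (case m of 0 \<Rightarrow> 0 | Suc m \<Rightarrow> C * B m)" if "s \<in> ?J" for m s
        using that C B norm_blinfun[of "L s"]
        by (cases m) (auto simp: \<Psi>_def intro!: order.trans[OF norm_blinfun] mult_mono)
      show "summable (\<lambda>m. case m of 0 \<Rightarrow> 0 | Suc m \<Rightarrow> C * B m)"
        by (subst summable_Suc_iff[symmetric]) (simp add: sB)
    qed
    have \<Psi>: "(\<Sum>m. \<Psi> m s) = L s (x s)" if "s \<in> ?J" for s
    proof -
      have "(\<lambda>m. L s (\<Phi> m s)) sums L s (x s)"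
        unfolding x_def using sums[OF that]
        by (intro bounded_linear.sums[OF blinfun.bounded_linear_right]) (rule summable_sums)
      then have "(\<lambda>m. \<Psi> (Suc m) s) sums L s (x s)" by (simp add: \<Psi>_def)
      then have "(\<lambda>m. \<Psi> m s) sums (L s (x s) + \<Psi> 0 s)" by (rule sums_Suc)
      then show ?thesis by (simp add: \<Psi>_def sums_iff)
    qed
    have "\<exists>g. \<forall>s\<in>?J. (\<lambda>m. \<Phi> m s) sums g s \<and> (g has_derivative (\<lambda>h. h *\<^sub>R L s (x s))) (at s within ?J)"
    proof (rule has_derivative_series)
      show "(\<Phi> m has_derivative (\<lambda>h. h *\<^sub>R \<Psi> m s)) (at s within ?J)" if "s \<in> ?J" for m s
        using dJ[OF that] by (cases m) (auto simp: \<Psi>_def \<Phi>_0 has_vector_derivative_def)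
      show "\<forall>\<^sub>F n in sequentially. \<forall>s\<in>?J. \<forall>h.
          norm ((\<Sum>m<n. h *\<^sub>R \<Psi> m s) - h *\<^sub>R L s (x s)) \<le> e * norm h" if "e > 0" for e
      proof -
        have "\<forall>\<^sub>F n in sequentially. \<forall>s\<in>?J. dist (\<Sum>m<n. \<Psi> m s) (\<Sum>m. \<Psi> m s) < e"
          using unif that by (simp add: uniform_limit_iff)
        then show ?thesis
        proof (eventually_elim, intro ballI allI)
          fix n s and h :: real
          assume *: "\<forall>s\<in>?J. dist (\<Sum>m<n. \<Psi> m s) (\<Sum>m. \<Psi> m s) < e" and s: "s \<in> ?J"
          have "norm ((\<Sum>m<n. h *\<^sub>R \<Psi> m s) - h *\<^sub>R L s (x s)) =
              \<bar>h\<bar> * dist (\<Sum>m<n. \<Psi> m s) (\<Sum>m. \<Psi> m s)"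
            by (simp add: \<Psi>[OF s] dist_norm scaleR_sum_right[symmetric] scaleR_diff_right[symmetric])
          also have "\<dots> \<le> \<bar>h\<bar> * e" using * s by (intro mult_left_mono) (auto intro: less_imp_le)
          finally show "norm ((\<Sum>m<n. h *\<^sub>R \<Psi> m s) - h *\<^sub>R L s (x s)) \<le> e * norm h"
            by (simp add: mult.commute)
        qed
      qed
      show "(\<lambda>m. \<Phi> m t) sums x t" unfolding x_def using sums[OF ab(3)] by (rule summable_sums)
    qed (use ab in auto)
    then obtain g where g: "\<And>s. s \<in> ?J \<Longrightarrow> (\<lambda>m. \<Phi> m s) sums g s"
      "\<And>s. s \<in> ?J \<Longrightarrow> (g has_derivative (\<lambda>h. h *\<^sub>R L s (x s))) (at s within ?J)" by blast
    have "x s = g s" if "s \<in> ?J" for s using g(1)[OF that] by (simp add: x_def sums_iff)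
    then have "(x has_vector_derivative L t (x t)) (at t within ?J)"
      using has_vector_derivative_transform[OF ab(3), of x g] g(2)[OF ab(3)]
      by (simp add: has_vector_derivative_def)
    then show ?thesis using ab by simp
  qed
  moreover have "x 0 = x0"
  proof -
    have "(\<lambda>m. \<Phi> m 0) sums (\<Sum>m\<in>{0}. \<Phi> m 0)" by (rule sums_finite) (simp_all add: \<Phi>_at_0)
    then show ?thesis by (simp add: x_def sums_iff \<Phi>_at_0)
  qed
  ultimately show ?thesis by blast
qed

context curve_domain
begin

lemma derivative_zero_imp_constant:
  fixes F :: "real \<Rightarrow> 'a::real_normed_vector"
  assumes F: "\<And>t. t \<in> I \<Longrightarrow> (F has_vector_derivative 0) (at t within I)" and "s \<in> I" "t \<in> I"
  shows "F t = F s"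
proof -
  obtain c where "\<And>t. t \<in> I \<Longrightarrow> F t = c"
    using has_vector_derivative_zero_constant[OF is_interval_convex[OF interval] F] by blast
  with assms show ?thesis by simp
qed

text \<open>Invertibility comes from solving the adjoint equation \<open>Y' = - Y M\<close> as well: \<open>Y X\<close> has derivative
zero, so it is constantly the identity. Smoothness comes from the equation, which keeps the curves
\<open>C X\<close> with \<open>C\<close> smooth closed under differentiation.\<close>

lemma matrix_ode_solution_exists:
  fixes M :: "real \<Rightarrow> real^'n^'n"
  assumes zero: "0 \<in> I" and M: "smooth_curve I M"
  obtains X :: "real \<Rightarrow> real^'n^'n" where "smooth_curve I X" "\<And>t. t \<in> I \<Longrightarrow> invertible (X t)"
    "\<And>t. t \<in> I \<Longrightarrow> (X has_vector_derivative M t ** X t) (at t within I)"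
proof -
  interpret mm: bounded_bilinear "\<lambda>(A::real^'n^'n) (B::real^'n^'n). A ** B"
    by (rule bounded_bilinear_matrix_mult)
  have cM: "continuous_on I M"
    using smooth_curve_has_derivative[OF M] by (rule continuous_on_vector_derivative)
  obtain X where X0: "X 0 = mat 1"
    and X: "\<And>t. t \<in> I \<Longrightarrow> (X has_vector_derivative mm.prod_right (M t) (X t)) (at t within I)"
    using linear_ode_solution_exists[OF interval zero
        bounded_linear.continuous_on[OF mm.bounded_linear_prod_right cM], of "mat 1"] by blast
  obtain Y where Y0: "Y 0 = mat 1"
    and Y: "\<And>t. t \<in> I \<Longrightarrow> (Y has_vector_derivative (- mm.prod_left (M t)) (Y t)) (at t within I)"
    using linear_ode_solution_exists[OF interval zero continuous_on_minus[OF
        bounded_linear.continuous_on[OF mm.bounded_linear_prod_left cM]], of "mat 1"] by blast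
  have X': "(X has_vector_derivative M t ** X t) (at t within I)" if "t \<in> I" for t
    using X[OF that] by simp
  have Y': "(Y has_vector_derivative - (Y t ** M t)) (at t within I)" if "t \<in> I" for t
    using Y[OF that] by (simp add: uminus_blinfun.rep_eq)
  have "Y t ** X t = mat 1" if t: "t \<in> I" for t
  proof -
    have "((\<lambda>t. Y t ** X t) has_vector_derivative 0) (at s within I)" if "s \<in> I" for s
      using matrix_mult_has_vector_derivative[OF Y'[OF that] X'[OF that]]
      by (simp add: matrix_mul_assoc matrix_mult_minus_left)
    from derivative_zero_imp_constant[OF this zero t] show ?thesis by (simp add: X0 Y0)
  qed
  then have "invertible (X t)" if "t \<in> I" for t
    using that by (auto simp: invertible_left_inverse)
  moreover have "smooth_curve I X"
  proof (rule smooth_curve_coinduct)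
    let ?S = "{\<lambda>t. C t ** X t | C :: real \<Rightarrow> real^'n^'n. smooth_curve I C}"
    show "X \<in> ?S" by (intro CollectI exI[of _ "\<lambda>_. mat 1"]) (simp add: smooth_curve_const)
    fix h assume "h \<in> ?S"
    then obtain C :: "real \<Rightarrow> real^'n^'n" where h: "h = (\<lambda>t. C t ** X t)" and C: "smooth_curve I C" by auto
    have "(h has_vector_derivative (C t ** M t + nderiv I 1 C t) ** X t) (at t within I)" if "t \<in> I" for t
      using matrix_mult_has_vector_derivative[OF smooth_curve_has_derivative[OF C that] X'[OF that]]
      by (simp add: h matrix_mul_assoc matrix_mult_add_left)
    moreover have "smooth_curve I (\<lambda>t. C t ** M t + nderiv I 1 C t)"
      by (intro smooth_curve_add smooth_curve_matrix_mult smooth_curve_nderiv C M)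
    ultimately show "\<exists>g\<in>?S. \<forall>t\<in>I. (h has_vector_derivative g t) (at t within I)"
      by (intro bexI[of _ "\<lambda>t. (C t ** M t + nderiv I 1 C t) ** X t"] ballI CollectI
          exI[of _ "\<lambda>t. C t ** M t + nderiv I 1 C t"] conjI refl)
  qed
  ultimately show ?thesis using X' by (intro that[of X]) auto
qed

end

section \<open>Combinations of blocks and block matrices\<close>

lemma span_columns_eq_range:
  fixes A :: "real^'n^'m"
  shows "span (columns A) = range ((*v) A)"
proof
  have "columns A \<subseteq> range ((*v) A)"
    by (auto simp: columns_def matrix_vector_mult_basis[symmetric])
  then show "span (columns A) \<subseteq> range ((*v) A)"
    by (intro span_minimal linear_subspace_image) auto
  show "range ((*v) A) \<subseteq> span (columns A)"
    by (auto simp: matrix_vector_mult_in_columnspace)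
qed

lemma columns_subset_subspace_iff:
  fixes R :: "real^'n^'m"
  assumes "subspace V"
  shows "columns R \<subseteq> V \<longleftrightarrow> (\<forall>w. R *v w \<in> V)"
proof
  assume "columns R \<subseteq> V"
  then have "span (columns R) \<subseteq> V" using assms by (rule span_minimal)
  then show "\<forall>w. R *v w \<in> V" using matrix_vector_mult_in_columnspace by blast
qed (auto simp: columns_def matrix_vector_mult_basis[symmetric])

text \<open>Congruences modulo these subspaces take the place of statements about spans of columns; unlike
sets of columns, their elements can be added and multiplied by matrices on the right.\<close>

definition combinations :: "(nat \<Rightarrow> real^'n^'m) \<Rightarrow> nat \<Rightarrow> (real^'c^'m) set" where
  "combinations F r = {\<Sum>p<r. F p ** D p | D. True}"

lemma combinationsI: "(\<Sum>p<r. F p ** D p) \<in> combinations F r"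
  by (auto simp: combinations_def)

lemma combinations_term: "p < r \<Longrightarrow> F p ** D \<in> combinations F r"
proof -
  assume "p < r"
  then have "(\<Sum>q<r. F q ** (if q = p then D else 0)) = (\<Sum>q<r. if q = p then F p ** D else 0)"
    by (intro sum.cong) (simp_all add: matrix_mult_zero_right)
  also have "\<dots> = F p ** D" using \<open>p < r\<close> by simp
  finally show ?thesis using combinationsI[of F "\<lambda>q. if q = p then D else 0" r] by simp
qed

lemma subspace_combinations:
  fixes F :: "nat \<Rightarrow> real^'n^'m"
  shows "subspace (combinations F r :: (real^'c^'m) set)"
  unfolding subspace_def
proof (intro conjI ballI allI)
  show "0 \<in> combinations F r"
    using combinationsI[of F "\<lambda>_. 0" r] by (simp add: matrix_mult_zero_right)
  fix R S :: "real^'c^'m" and c :: real assume "R \<in> combinations F r" "S \<in> combinations F r"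
  then obtain D E :: "nat \<Rightarrow> real^'c^'n" where "R = (\<Sum>p<r. F p ** D p)" "S = (\<Sum>p<r. F p ** E p)"
    by (auto simp: combinations_def)
  then have "R + S = (\<Sum>p<r. F p ** (D p + E p))" "c *\<^sub>R R = (\<Sum>p<r. F p ** (c *\<^sub>R D p))"
    by (simp_all add: matrix_mult_add_right sum.distrib matrix_mult_scaleR_right scaleR_sum_right)
  then show "R + S \<in> combinations F r" "c *\<^sub>R R \<in> combinations F r"
    by (simp_all add: combinationsI)
qed

lemma combinations_mult: "R \<in> combinations F r \<Longrightarrow> R ** X \<in> combinations F r"
  unfolding combinations_def
  by (auto simp: matrix_mult_sum_left matrix_mul_assoc[symmetric])

lemma columns_subset_span_iff_combinations:
  fixes R :: "real^'c^'m" and F :: "nat \<Rightarrow> real^'n^'m"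
  shows "columns R \<subseteq> span (\<Union>p<r. columns (F p)) \<longleftrightarrow> R \<in> combinations F r"
proof
  let ?W = "\<Union>p<r. columns (F p)"
  assume R: "columns R \<subseteq> span ?W"
  define V where "V = {\<Sum>p<r. F p *v w p | w. True}"
  have "subspace V"
    unfolding subspace_def
  proof (intro conjI ballI allI)
    show "0 \<in> V" unfolding V_def by (intro CollectI exI[of _ "\<lambda>_. 0"]) simp
    fix x y c assume "x \<in> V" "y \<in> V"
    then obtain u v where "x = (\<Sum>p<r. F p *v u p)" "y = (\<Sum>p<r. F p *v v p)"
      by (auto simp: V_def)
    then have "x + y = (\<Sum>p<r. F p *v (u p + v p))" "c *\<^sub>R x = (\<Sum>p<r. F p *v (c *\<^sub>R u p))"
      by (simp_all add: matrix_vector_right_distrib sum.distrib matrix_vector_mult_scaleR scaleR_sum_right)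
    then show "x + y \<in> V" "c *\<^sub>R x \<in> V" by (auto simp: V_def)
  qed
  moreover have "?W \<subseteq> V"
  proof
    fix x assume "x \<in> ?W"
    then obtain p q where pq: "p < r" "x = column q (F p)" by (auto simp: columns_def)
    have "(\<Sum>p'<r. F p' *v (if p' = p then axis q 1 else 0)) =
        (\<Sum>p'<r. if p' = p then F p *v axis q 1 else 0)"
      by (intro sum.cong) simp_all
    also have "\<dots> = x" using pq by (simp add: matrix_vector_mult_basis)
    finally have "x = (\<Sum>p'<r. F p' *v (if p' = p then axis q 1 else 0))" ..
    then show "x \<in> V" unfolding V_def
      by (intro CollectI exI[of _ "\<lambda>p'. if p' = p then axis q 1 else 0"] conjI TrueI)
  qed
  ultimately have "span ?W \<subseteq> V" by (intro span_minimal)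
  then have "\<forall>c. \<exists>w. column c R = (\<Sum>p<r. F p *v w p)"
    using R by (auto simp: columns_def V_def)
  then obtain w where w: "\<And>c. column c R = (\<Sum>p<r. F p *v w c p)" by metis
  have "R = (\<Sum>p<r. F p ** (\<chi> q c. w c p $ q))"
  proof -
    have "R $ i $ c = (\<Sum>p<r. F p ** (\<chi> q c. w c p $ q)) $ i $ c" for i c
      using arg_cong[OF w[of c], of "\<lambda>x. x $ i"]
      by (simp add: column_def matrix_matrix_mult_def matrix_vector_mult_def)
    then show ?thesis by (simp add: vec_eq_iff)
  qed
  then show "R \<in> combinations F r"
    using combinationsI[of F "\<lambda>p. \<chi> q c. w c p $ q" r] by simp
next
  let ?W = "\<Union>p<r. columns (F p)"
  assume "R \<in> combinations F r"
  then obtain D where D: "R = (\<Sum>p<r. F p ** D p)" by (auto simp: combinations_def)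
  have "R *v w \<in> span ?W" for w
  proof -
    have "R *v w = (\<Sum>p<r. F p *v (D p *v w))"
      unfolding D by (induction r) (simp_all add: matrix_vector_mult_add_rdistrib matrix_vector_mul_assoc)
    moreover have "F p *v (D p *v w) \<in> span ?W" if "p < r" for p
      using span_mono[of "columns (F p)" ?W] that matrix_vector_mult_in_columnspace[of "F p" "D p *v w"]
      by blast
    ultimately show ?thesis by (auto intro!: span_sum)
  qed
  then show "columns R \<subseteq> span ?W" by (simp add: columns_subset_subspace_iff)
qed

text \<open>For \<open>F p = A^(p)(t)\<close> this is the jet matrix. Having it for arbitrary blocks lets matrices act on it
block by block.\<close>

definition block_row :: "nat \<Rightarrow> (nat \<Rightarrow> real^'n^'m) \<Rightarrow> real^'m^'m" where
  "block_row k F = (\<chi> i j. let (p, q) = (block_index k j :: nat \<times> 'n) in F p $ i $ q)"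

lemma jet_matrix_eq_block_row: "jet_matrix k I A t = block_row k (\<lambda>p. nderiv I p A t)"
  by (simp add: jet_matrix_def block_row_def)

lemma mult_block_row: "T ** block_row k F = block_row k (\<lambda>p. T ** F p)"
  by (simp add: vec_eq_iff block_row_def matrix_matrix_mult_def split_beta Let_def)

definition block_column :: "nat \<Rightarrow> (nat \<Rightarrow> real^'c^'n) \<Rightarrow> real^'c^'m" where
  "block_column k D = (\<chi> j c. let (p, q) = (block_index k j :: nat \<times> 'n) in D p $ q $ c)"

context
  fixes k :: nat
  assumes card: "CARD('m::finite) = k * CARD('n::finite)"
begin

lemma bij_betw_block_index:
  "bij_betw (block_index k :: 'm \<Rightarrow> nat \<times> 'n) UNIV ({..<k} \<times> UNIV)"
proof -
  have "\<exists>e. bij_betw e (UNIV :: 'm set) ({..<k} \<times> (UNIV :: 'n set))"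
    by (rule finite_same_card_bij) (simp_all add: card)
  then show ?thesis unfolding block_index_def by (rule someI_ex)
qed

lemma block_index_surj:
  assumes "p < k"
  obtains j :: 'm where "block_index k j = (p, q :: 'n)"
proof -
  have "(p, q) \<in> range (block_index k :: 'm \<Rightarrow> nat \<times> 'n)"
    using bij_betw_imp_surj_on[OF bij_betw_block_index] assms by simp
  then show ?thesis using that by force
qed

lemma block_index_less:
  fixes j :: 'm
  assumes "block_index k j = (p, q :: 'n)"
  shows "p < k"
proof -
  have "(block_index k j :: nat \<times> 'n) \<in> {..<k} \<times> UNIV"
    by (rule bij_betwE[OF bij_betw_block_index, rule_format]) simp
  then show ?thesis using assms by simp
qed

lemma block_row_eq_iff:
  fixes F G :: "nat \<Rightarrow> real^'n^'m"
  shows "block_row k F = block_row k G \<longleftrightarrow> (\<forall>p<k. F p = G p)"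
proof
  assume *: "block_row k F = block_row k G"
  show "\<forall>p<k. F p = G p"
  proof (intro allI impI)
    fix p assume "p < k"
    have "F p $ i $ q = G p $ i $ q" for i q
    proof -
      obtain j :: 'm where "block_index k j = (p, q)" using block_index_surj[OF \<open>p < k\<close>] .
      then show ?thesis using arg_cong[OF *, of "\<lambda>M. M $ i $ j"] by (simp add: block_row_def)
    qed
    then show "F p = G p" by (simp add: vec_eq_iff)
  qed
next
  assume *: "\<forall>p<k. F p = G p"
  have "fst (block_index k j :: nat \<times> 'n) < k" for j :: 'm
    by (rule block_index_less[of j _ "snd (block_index k j)"]) simp
  with * show "block_row k F = block_row k G"
    by (simp add: vec_eq_iff block_row_def split_beta Let_def)
qed

lemma block_column_eq_iff:
  fixes D E :: "nat \<Rightarrow> real^'c^'n"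
  shows "(block_column k D :: real^'c^'m) = block_column k E \<longleftrightarrow> (\<forall>p<k. D p = E p)"
proof
  assume *: "(block_column k D :: real^'c^'m) = block_column k E"
  show "\<forall>p<k. D p = E p"
  proof (intro allI impI)
    fix p assume "p < k"
    have "D p $ q $ c = E p $ q $ c" for q c
    proof -
      obtain j :: 'm where "block_index k j = (p, q)" using block_index_surj[OF \<open>p < k\<close>] .
      then show ?thesis using arg_cong[OF *, of "\<lambda>M. M $ j $ c"] by (simp add: block_column_def)
    qed
    then show "D p = E p" by (simp add: vec_eq_iff)
  qed
next
  assume *: "\<forall>p<k. D p = E p"
  have "fst (block_index k j :: nat \<times> 'n) < k" for j :: 'm
    by (rule block_index_less[of j _ "snd (block_index k j)"]) simp
  with * show "(block_column k D :: real^'c^'m) = block_column k E"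
    by (simp add: vec_eq_iff block_column_def split_beta Let_def)
qed

lemma block_row_mult_column:
  fixes F :: "nat \<Rightarrow> real^'n^'m" and D :: "nat \<Rightarrow> real^'c^'n"
  shows "block_row k F ** (block_column k D :: real^'c^'m) = (\<Sum>p<k. F p ** D p)"
proof -
  have "(block_row k F ** (block_column k D :: real^'c^'m)) $ i $ c = (\<Sum>p<k. F p ** D p) $ i $ c" for i c
  proof -
    have "(block_row k F ** (block_column k D :: real^'c^'m)) $ i $ c =
        (\<Sum>(j::'m)\<in>UNIV. (\<lambda>(p, q). F p $ i $ q * D p $ q $ c) (block_index k j))"
      by (simp add: matrix_matrix_mult_def block_row_def block_column_def split_beta Let_def)
    also have "\<dots> = (\<Sum>(p, q)\<in>{..<k} \<times> UNIV. F p $ i $ q * D p $ q $ c)"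
      by (rule sum.reindex_bij_betw[OF bij_betw_block_index])
    also have "\<dots> = (\<Sum>p<k. F p ** D p) $ i $ c"
      by (simp add: sum.cartesian_product[symmetric] matrix_matrix_mult_def)
    finally show ?thesis .
  qed
  then show ?thesis by (simp add: vec_eq_iff)
qed

lemma block_column_surj:
  fixes C :: "real^'c^'m"
  defines "j \<equiv> \<lambda>p (q :: 'n). inv_into UNIV (block_index k) (p, q) :: 'm"
  shows "block_column k (\<lambda>p. \<chi> q c. C $ j p q $ c) = C"
  using bij_betw_imp_inj_on[OF bij_betw_block_index]
  by (simp add: vec_eq_iff block_column_def split_beta Let_def j_def inv_into_f_f)

lemma columns_block_row:
  fixes F :: "nat \<Rightarrow> real^'n^'m"
  shows "columns (block_row k F) = (\<Union>p<k. columns (F p))"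
proof (intro equalityI subsetI)
  fix x assume "x \<in> columns (block_row k F)"
  then obtain j where j: "x = column j (block_row k F)" by (auto simp: columns_def)
  obtain p q where pq: "block_index k j = (p, q :: 'n)" by force
  have "p < k" using block_index_less[OF pq] .
  moreover have "x = column q (F p)" by (simp add: j pq column_def block_row_def vec_eq_iff)
  ultimately show "x \<in> (\<Union>p<k. columns (F p))" by (auto simp: columns_def)
next
  fix x assume "x \<in> (\<Union>p<k. columns (F p))"
  then obtain p q where pq: "p < k" "x = column q (F p)" by (auto simp: columns_def)
  obtain j :: 'm where "block_index k j = (p, q)" using block_index_surj[OF pq(1)] .
  then have "x = column j (block_row k F)" by (simp add: pq column_def block_row_def vec_eq_iff)
  then show "x \<in> columns (block_row k F)" by (auto simp: columns_def)
qed

lemma invertible_block_row_iff: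
  fixes F :: "nat \<Rightarrow> real^'n^'m"
  shows "invertible (block_row k F) \<longleftrightarrow> span (\<Union>p<k. columns (F p)) = UNIV"
  by (simp add: invertible_right_inverse matrix_right_invertible_span_columns columns_block_row
      span_vec_eq)

end

section \<open>Fanning frames and their coefficients\<close>

text \<open>The factor of \<open>A^(p)\<close> when the equation with coefficients \<open>P\<close> is solved for \<open>A^(k)\<close>, as in
\<open>nderiv_top_expansion\<close> below.\<close>

definition top_coeff :: "nat \<Rightarrow> (nat \<Rightarrow> real^'n^'n) \<Rightarrow> nat \<Rightarrow> real^'n^'n" where
  "top_coeff k P p = - (real (k choose (k - p)) *\<^sub>R P (k - p))"

context curve_domain
begin

lemma smooth_curve_frame: "fanning_frame k I A \<Longrightarrow> smooth_curve I A"
  by (simp add: fanning_frame_def)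

context
  fixes k :: nat
  assumes card: "CARD('m::finite) = k * CARD('n::finite)"
begin

text \<open>Fanning means that the columns of \<open>A, A', \<dots>, A^(k-1)\<close> span the whole space. In this form it
does not mention the enumeration of the columns.\<close>

lemma fanning_frame_iff_span:
  fixes A :: "real \<Rightarrow> real^'n^'m"
  shows "fanning_frame k I A \<longleftrightarrow>
    smooth_curve I A \<and> (\<forall>t\<in>I. span (\<Union>p<k. columns (nderiv I p A t)) = UNIV)"
  by (simp add: fanning_frame_def jet_matrix_eq_block_row invertible_block_row_iff[OF card])

text \<open>The blocks of a product with the invertible jet matrix are determined by the product.\<close>

lemma jet_expansion_unique:
  fixes A :: "real \<Rightarrow> real^'n^'m" and D E :: "nat \<Rightarrow> real^'c^'n"
  assumes A: "fanning_frame k I A" and t: "t \<in> I"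
    and eq: "(\<Sum>p<k. nderiv I p A t ** D p) = (\<Sum>p<k. nderiv I p A t ** E p)" and p: "p < k"
  shows "D p = E p"
proof -
  let ?J = "jet_matrix k I A t"
  have inv: "invertible ?J" using A t by (simp add: fanning_frame_def)
  have "?J ** block_column k D = ?J ** block_column k E"
    using eq by (simp add: jet_matrix_eq_block_row block_row_mult_column[OF card])
  then have "matrix_inv ?J ** (?J ** block_column k D) = matrix_inv ?J ** (?J ** block_column k E)"
    by simp
  then have "(block_column k D :: real^'c^'m) = block_column k E"
    by (simp add: matrix_mul_assoc matrix_inv_left inv)
  with p show ?thesis by (simp add: block_column_eq_iff[OF card])
qed

lemma smooth_curve_jet_matrix:
  fixes A :: "real \<Rightarrow> real^'n^'m"
  assumes "smooth_curve I A"
  shows "smooth_curve I (jet_matrix k I A)"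
proof (rule smooth_curve_matrixI)
  fix i j :: 'm
  obtain p q where "block_index k j = (p, q :: 'n)" by force
  then show "smooth_curve I (\<lambda>t. jet_matrix k I A t $ i $ j)"
    by (simp add: jet_matrix_def smooth_curve_matrix_component smooth_curve_nderiv assms)
qed

lemma jet_expansion_exists:
  fixes A :: "real \<Rightarrow> real^'n^'m" and R :: "real \<Rightarrow> real^'c^'m"
  assumes A: "fanning_frame k I A" and R: "smooth_curve I R"
  shows "\<exists>D :: nat \<Rightarrow> real \<Rightarrow> real^'c^'n. (\<forall>p. smooth_curve I (D p)) \<and>
    (\<forall>t\<in>I. R t = (\<Sum>p<k. nderiv I p A t ** D p t))"
proof -
  define C where "C t = matrix_inv (jet_matrix k I A t) ** R t" for t
  define j :: "nat \<Rightarrow> 'n \<Rightarrow> 'm" where "j p q = inv_into UNIV (block_index k) (p, q)" for p q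
  define D :: "nat \<Rightarrow> real \<Rightarrow> real^'c^'n" where "D p t = (\<chi> q c. C t $ j p q $ c)" for p t
  have "smooth_curve I C"
    unfolding C_def using A
    by (intro smooth_curve_matrix_mult smooth_curve_matrix_inv smooth_curve_jet_matrix R)
      (simp_all add: fanning_frame_def)
  then have "smooth_curve I (D p)" for p
    by (intro smooth_curve_matrixI) (simp add: D_def smooth_curve_matrix_component)
  moreover have "R t = (\<Sum>p<k. nderiv I p A t ** D p t)" if "t \<in> I" for t
  proof -
    have "block_column k (\<lambda>p. D p t) = C t"
      unfolding D_def j_def by (rule block_column_surj[OF card])
    then have "(\<Sum>p<k. nderiv I p A t ** D p t) = jet_matrix k I A t ** C t"
      using block_row_mult_column[OF card, of "\<lambda>p. nderiv I p A t" "\<lambda>p. D p t"]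
      by (simp add: jet_matrix_eq_block_row)
    also have "\<dots> = R t"
      using A that by (simp add: C_def matrix_mul_assoc matrix_inv_right fanning_frame_def)
    finally show ?thesis ..
  qed
  ultimately show ?thesis by blast
qed

lemma sum_coeffs_reindex: "(\<Sum>i=1..k. f (k - i) i) = (\<Sum>p<k. f p (k - p))"
  by (rule sum.reindex_bij_witness[of _ "\<lambda>p. k - p" "\<lambda>i. k - i"]) auto

lemma is_coeffs_coeffs:
  fixes A :: "real \<Rightarrow> real^'n^'m"
  assumes A: "fanning_frame k I A"
  shows "is_coeffs k I A (coeffs k I A)"
proof -
  obtain D :: "nat \<Rightarrow> real \<Rightarrow> real^'n^'n" where D: "\<And>p. smooth_curve I (D p)"
    "\<And>t. t \<in> I \<Longrightarrow> nderiv I k A t = (\<Sum>p<k. nderiv I p A t ** D p t)"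
    using jet_expansion_exists[OF A smooth_curve_nderiv[OF smooth_curve_frame[OF A], of k]] by blast
  define P where "P i = (if i = 0 then (\<lambda>t. mat 1) else (\<lambda>t. (- 1 / real (k choose i)) *\<^sub>R D (k - i) t))" for i
  have "is_coeffs k I A P"
    unfolding is_coeffs_def
  proof (intro conjI ballI)
    show "smooth_curve I (P i)" if "i \<in> {1..k}" for i
    proof -
      have "smooth_curve I (\<lambda>t. c *\<^sub>R D p t)" for c p
        by (rule smooth_curve_linear[OF bounded_linear_scaleR_right D(1)])
      from this[of "- 1 / real (k choose i)" "k - i"] show ?thesis
        using that by (simp add: P_def)
    qed
    fix t assume t: "t \<in> I"
    have "(\<Sum>i=1..k. real (k choose i) *\<^sub>R (nderiv I (k - i) A t ** P i t)) =
        (\<Sum>i=1..k. - (nderiv I (k - i) A t ** D (k - i) t))"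
      by (intro sum.cong) (auto simp: P_def matrix_mult_scaleR_right matrix_mult_minus_right)
    also have "\<dots> = (\<Sum>p<k. - (nderiv I p A t ** D p t))"
      by (rule sum_coeffs_reindex)
    finally show "nderiv I k A t + (\<Sum>i=1..k. real (k choose i) *\<^sub>R (nderiv I (k - i) A t ** P i t)) = 0"
      by (simp add: D(2)[OF t] sum_negf)
  qed (simp add: P_def)
  then show ?thesis unfolding coeffs_def by (rule someI[of "is_coeffs k I A"])
qed

lemma smooth_curve_coeffs:
  fixes A :: "real \<Rightarrow> real^'n^'m"
  shows "fanning_frame k I A \<Longrightarrow> i \<in> {1..k} \<Longrightarrow> smooth_curve I (coeffs k I A i)"
  using is_coeffs_coeffs by (simp add: is_coeffs_def)

lemma nderiv_top_expansion:
  fixes A :: "real \<Rightarrow> real^'n^'m"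
  assumes A: "fanning_frame k I A" and t: "t \<in> I"
  shows "nderiv I k A t = (\<Sum>p<k. nderiv I p A t ** top_coeff k (\<lambda>i. coeffs k I A i t) p)"
proof -
  have "nderiv I k A t =
      - (\<Sum>i=1..k. real (k choose i) *\<^sub>R (nderiv I (k - i) A t ** coeffs k I A i t))"
    using is_coeffs_coeffs[OF A] t by (simp add: is_coeffs_def eq_neg_iff_add_eq_0)
  also have "\<dots> = - (\<Sum>p<k. real (k choose (k - p)) *\<^sub>R (nderiv I p A t ** coeffs k I A (k - p) t))"
    by (subst sum_coeffs_reindex) simp
  also have "\<dots> = (\<Sum>p<k. nderiv I p A t ** top_coeff k (\<lambda>i. coeffs k I A i t) p)"
    by (simp add: top_coeff_def sum_negf matrix_mult_minus_right matrix_mult_scaleR_right)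
  finally show ?thesis .
qed

lemma coeffs_unique:
  fixes A :: "real \<Rightarrow> real^'n^'m"
  assumes A: "fanning_frame k I A" and t: "t \<in> I"
    and P: "nderiv I k A t = (\<Sum>p<k. nderiv I p A t ** top_coeff k P p)" and i: "i \<in> {1..k}"
  shows "coeffs k I A i t = P i"
proof -
  have "top_coeff k (\<lambda>i. coeffs k I A i t) (k - i) = top_coeff k P (k - i)"
    by (rule jet_expansion_unique[OF A t]) (use nderiv_top_expansion[OF A t] P i in auto)
  then show ?thesis using i by (simp add: top_coeff_def)
qed

text \<open>Multiplying the equation for \<open>A\<close> by constants \<open>T\<close> on the left and \<open>X\<close> on the right gives the
equation for \<open>T A X\<close>, with each coefficient conjugated by \<open>X\<close>.\<close>

lemma coeffs_change_constant:
  fixes A B :: "real \<Rightarrow> real^'n^'m" and T :: "real^'m^'m" and X :: "real^'n^'n"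
  assumes A: "fanning_frame k I A" and B: "fanning_frame k I B" and X: "invertible X"
    and eq: "\<And>t. t \<in> I \<Longrightarrow> B t = T ** A t ** X" and t: "t \<in> I" and i: "i \<in> {1..k}"
  shows "coeffs k I B i t = matrix_inv X ** coeffs k I A i t ** X"
proof (rule coeffs_unique[OF B t _ i])
  have bl: "bounded_linear (\<lambda>M. T ** M ** X)"
    using bounded_linear_compose[OF bounded_bilinear.bounded_linear_left[OF bounded_bilinear_matrix_mult]
        bounded_bilinear.bounded_linear_right[OF bounded_bilinear_matrix_mult]] .
  have dB: "nderiv I p B t = T ** nderiv I p A t ** X" for p
  proof -
    have "nderiv I p B t = nderiv I p (\<lambda>t. T ** A t ** X) t"
      by (rule nderiv_cong[symmetric, OF smooth_curve_frame[OF B] eq t])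
    also have "\<dots> = T ** nderiv I p A t ** X"
      by (rule nderiv_linear[OF bl smooth_curve_frame[OF A] t])
    finally show ?thesis .
  qed
  let ?P = "\<lambda>i. coeffs k I A i t" and ?Q = "\<lambda>i. matrix_inv X ** coeffs k I A i t ** X"
  have "nderiv I k B t = T ** (\<Sum>p<k. nderiv I p A t ** top_coeff k ?P p) ** X"
    by (simp only: dB nderiv_top_expansion[OF A t])
  also have "\<dots> = (\<Sum>p<k. T ** nderiv I p A t ** top_coeff k ?P p ** X)"
    by (simp add: matrix_mult_sum_left matrix_mult_sum_right matrix_mul_assoc)
  also have "\<dots> = (\<Sum>p<k. nderiv I p B t ** top_coeff k ?Q p)"
  proof (intro sum.cong refl)
    fix p
    have "X ** top_coeff k ?Q p = - (real (k choose (k - p)) *\<^sub>R (X ** matrix_inv X ** ?P (k - p) ** X))"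
      by (simp add: top_coeff_def matrix_mult_minus_right matrix_mult_scaleR_right matrix_mul_assoc)
    also have "\<dots> = top_coeff k ?P p ** X"
      by (simp add: top_coeff_def matrix_inv_right X matrix_mult_minus_left matrix_mult_scaleR_left)
    finally show "T ** nderiv I p A t ** top_coeff k ?P p ** X = nderiv I p B t ** top_coeff k ?Q p"
      by (simp add: dB matrix_mul_assoc[symmetric])
  qed
  finally show "nderiv I k B t = (\<Sum>p<k. nderiv I p B t ** top_coeff k ?Q p)" .
qed

lemma fanning_frame_left_mult:
  fixes A :: "real \<Rightarrow> real^'n^'m" and T :: "real^'m^'m"
  assumes A: "fanning_frame k I A" and T: "invertible T"
  shows "fanning_frame k I (\<lambda>t. T ** A t)"
proof -
  note bl = bounded_bilinear.bounded_linear_right[OF bounded_bilinear_matrix_mult, of T]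
  have "jet_matrix k I (\<lambda>t. T ** A t) t = T ** jet_matrix k I A t" if "t \<in> I" for t
    using nderiv_linear[OF bl smooth_curve_frame[OF A] that]
    by (simp add: jet_matrix_eq_block_row mult_block_row)
  then show ?thesis
    using A T by (simp add: fanning_frame_def smooth_curve_linear[OF bl] invertible_mult)
qed

text \<open>By the Leibniz rule the derivatives of \<open>A X\<close> arise from those of \<open>A\<close> by a block triangular matrix
with \<open>X\<close> on the diagonal. Solving for \<open>A^(p) X\<close> shows, by induction on \<open>p\<close>, that the two jets span the same
space.\<close>

lemma fanning_frame_right_mult:
  fixes A :: "real \<Rightarrow> real^'n^'m" and X :: "real \<Rightarrow> real^'n^'n"
  assumes A: "fanning_frame k I A" and X: "smooth_curve I X"
    and inv: "\<And>t. t \<in> I \<Longrightarrow> invertible (X t)"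
  shows "fanning_frame k I (\<lambda>t. A t ** X t)"
  unfolding fanning_frame_iff_span
proof (intro conjI ballI)
  let ?B = "\<lambda>t. A t ** X t"
  show "smooth_curve I ?B" by (intro smooth_curve_matrix_mult smooth_curve_frame[OF A] X)
  fix t assume t: "t \<in> I"
  define V where "V = span (\<Union>p<k. columns (nderiv I p ?B t))"
  have V: "subspace V" by (simp add: V_def)
  have B_in_V: "nderiv I p ?B t *v w \<in> V" if "p < k" for p w
    using span_mono[of "columns (nderiv I p ?B t)" "\<Union>p<k. columns (nderiv I p ?B t)"] that
      matrix_vector_mult_in_columnspace[of "nderiv I p ?B t" w]
    unfolding V_def by blast
  have "\<forall>w. nderiv I p A t *v w \<in> V" if "p < k" for p
    using that
  proof (induction p rule: less_induct)
    case (less p)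
    show ?case
    proof
      fix w
      define u where "u = matrix_inv (X t) *v w"
      let ?rest = "\<Sum>i\<in>{..p} - {0}. real (p choose i) *\<^sub>R (nderiv I (p - i) A t ** nderiv I i X t)"
      have "nderiv I p ?B t = nderiv I p A t ** X t + ?rest"
        using nderiv_matrix_mult[OF smooth_curve_frame[OF A] X t, of p]
        by (simp add: sum.remove[of "{..p}" 0])
      then have "nderiv I p A t *v (X t *v u) = nderiv I p ?B t *v u - ?rest *v u"
        by (simp add: matrix_vector_mult_add_rdistrib matrix_vector_mul_assoc)
      moreover have "?rest *v u = (\<Sum>i\<in>{..p} - {0}.
          real (p choose i) *\<^sub>R (nderiv I (p - i) A t *v (nderiv I i X t *v u)))"
        by (induction rule: finite_induct[OF finite_Diff[OF finite_atMost]])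
          (simp_all add: matrix_vector_mult_add_rdistrib scaleR_matrix_vector_assoc[symmetric]
            matrix_vector_mul_assoc)
      moreover have "nderiv I (p - i) A t *v v \<in> V" if "i \<in> {..p} - {0}" for i v
        using less.IH[of "p - i"] less.prems that by auto
      moreover have "X t *v u = w"
        by (simp add: u_def matrix_vector_mul_assoc matrix_inv_right inv t)
      ultimately show "nderiv I p A t *v w \<in> V"
        using B_in_V[OF less.prems] V by (auto intro!: subspace_diff subspace_sum subspace_scale)
    qed
  qed
  then have "(\<Union>p<k. columns (nderiv I p A t)) \<subseteq> V"
    by (auto simp: columns_subset_subspace_iff[OF V, THEN iffD2] subset_iff
        dest: columns_subset_subspace_iff[OF V, THEN iffD2, THEN subsetD])
  then have "span (\<Union>p<k. columns (nderiv I p A t)) \<subseteq> V" using V by (rule span_minimal)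
  then show "span (\<Union>p<k. columns (nderiv I p ?B t)) = UNIV"
    using A t by (auto simp: fanning_frame_iff_span V_def)
qed

context
  assumes k: "k \<ge> 2"
begin

lemma nderiv_top_mod_lower:
  fixes A :: "real \<Rightarrow> real^'n^'m"
  assumes A: "fanning_frame k I A" and t: "t \<in> I"
  shows "nderiv I k A t + nderiv I (k - 1) A t ** (real k *\<^sub>R coeffs k I A 1 t)
    \<in> combinations (\<lambda>p. nderiv I p A t) (k - 1)"
proof -
  obtain r where r: "k = Suc r" using k by (cases k) auto
  let ?C = "top_coeff k (\<lambda>i. coeffs k I A i t)"
  have "nderiv I k A t = (\<Sum>p<k - 1. nderiv I p A t ** ?C p) + nderiv I (k - 1) A t ** ?C (k - 1)"
    unfolding nderiv_top_expansion[OF A t] by (simp add: r)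
  moreover have "?C (k - 1) = - (real k *\<^sub>R coeffs k I A 1 t)"
    by (simp add: top_coeff_def r)
  ultimately have "nderiv I k A t + nderiv I (k - 1) A t ** (real k *\<^sub>R coeffs k I A 1 t) =
      (\<Sum>p<k - 1. nderiv I p A t ** ?C p)"
    by (simp add: matrix_mult_minus_right)
  then show ?thesis by (simp add: combinationsI)
qed

lemma subleading_combination_imp_zero:
  fixes A :: "real \<Rightarrow> real^'n^'m" and Z :: "real^'n^'n"
  assumes A: "fanning_frame k I A" and t: "t \<in> I"
    and Z: "nderiv I (k - 1) A t ** Z \<in> combinations (\<lambda>p. nderiv I p A t) (k - 1)"
  shows "Z = 0"
proof -
  obtain r where r: "k = Suc r" using k by (cases k) auto
  obtain D where D: "nderiv I r A t ** Z = (\<Sum>p<r. nderiv I p A t ** D p)"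
    using Z by (auto simp: combinations_def r)
  have "(if r = r then Z else 0) = (if r < r then D r else 0)"
    by (rule jet_expansion_unique[OF A t, of "\<lambda>p. if p = r then Z else 0" "\<lambda>p. if p < r then D p else 0"])
      (simp_all add: r D matrix_mult_zero_right)
  then show ?thesis by simp
qed

text \<open>Modulo the lower derivatives, \<open>A^(k)\<close> is \<open>- k A^(k-1) P\<^sub>1\<close>, and no nonzero right multiple of \<open>A^(k-1)\<close> is a combination
of them.\<close>

lemma normal_frame_iff:
  fixes A :: "real \<Rightarrow> real^'n^'m"
  shows "normal_frame k I A \<longleftrightarrow> fanning_frame k I A \<and> (\<forall>t\<in>I. coeffs k I A 1 t = 0)"
proof -
  have "columns (nderiv I k A t) \<subseteq> span (\<Union>i\<le>k - 2. columns (nderiv I i A t)) \<longleftrightarrow>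
      coeffs k I A 1 t = 0" if A: "fanning_frame k I A" and t: "t \<in> I" for t
  proof -
    let ?W = "combinations (\<lambda>p. nderiv I p A t) (k - 1) :: (real^'n^'m) set"
    let ?Z = "real k *\<^sub>R coeffs k I A 1 t"
    note W = subspace_combinations[of "\<lambda>p. nderiv I p A t" "k - 1", where 'c = 'n]
    have "{..k - 2} = {..<k - 1}" using k by auto
    then have "columns (nderiv I k A t) \<subseteq> span (\<Union>i\<le>k - 2. columns (nderiv I i A t)) \<longleftrightarrow>
        nderiv I k A t \<in> ?W"
      by (simp add: columns_subset_span_iff_combinations)
    also have "\<dots> \<longleftrightarrow> nderiv I (k - 1) A t ** ?Z \<in> ?W"
      using subspace_diff[OF W nderiv_top_mod_lower[OF A t], of "nderiv I k A t"]
        subspace_diff[OF W nderiv_top_mod_lower[OF A t], of "nderiv I (k - 1) A t ** ?Z"] by auto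
    also have "\<dots> \<longleftrightarrow> coeffs k I A 1 t = 0"
      using subleading_combination_imp_zero[OF A t, of ?Z] subspace_0[OF W] k
      by (auto simp: matrix_mult_zero_right)
    finally show ?thesis .
  qed
  then show ?thesis by (auto simp: normal_frame_def)
qed

text \<open>Work modulo \<open>A, \<dots>, A^(k-2)\<close>, where only the leading terms of the Leibniz rule survive:
\<open>B^(k-1) \<equiv> A^(k-1) X\<close> and \<open>B^(k) \<equiv> A^(k) X + k A^(k-1) X'\<close>. Substituting
\<open>A^(k) \<equiv> - k A^(k-1) P\<^sub>1\<close> and the same for \<open>B\<close>, and comparing the factors of \<open>A^(k-1)\<close>, gives the
transformation rule.\<close>

lemma coeffs_1_right_mult:
  fixes A B :: "real \<Rightarrow> real^'n^'m" and X :: "real \<Rightarrow> real^'n^'n"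
  assumes A: "fanning_frame k I A" and B: "fanning_frame k I B" and X: "smooth_curve I X"
    and eq: "\<And>t. t \<in> I \<Longrightarrow> B t = A t ** X t" and t: "t \<in> I"
  shows "X t ** coeffs k I B 1 t = coeffs k I A 1 t ** X t - nderiv I 1 X t"
proof -
  obtain r where r: "k = Suc (Suc r)" using k le_Suc_ex[of 2 k] by auto
  define F where "F p = nderiv I p A t" for p
  define G where "G p = nderiv I p B t" for p
  let ?a = "real k *\<^sub>R coeffs k I A 1 t" and ?b = "real k *\<^sub>R coeffs k I B 1 t"
    and ?x = "real k *\<^sub>R nderiv I 1 X t"
  let ?W = "combinations F (Suc r) :: (real^'n^'m) set"
  have W: "subspace ?W" by (rule subspace_combinations)
  have G: "G m = (\<Sum>i\<le>m. real (m choose i) *\<^sub>R (F (m - i) ** nderiv I i X t))" for m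
    unfolding G_def F_def nderiv_matrix_mult[OF smooth_curve_frame[OF A] X t, symmetric]
    by (rule nderiv_cong[symmetric, OF smooth_curve_frame[OF B] eq t])
  have low: "G p \<in> ?W" if "p < Suc r" for p
    unfolding G by (intro subspace_sum subspace_scale W combinations_term) (use that in auto)
  have G1: "G (Suc r) - F (Suc r) ** X t \<in> ?W"
  proof -
    have "G (Suc r) - F (Suc r) ** X t =
        (\<Sum>i\<le>r. real (Suc r choose Suc i) *\<^sub>R (F (r - i) ** nderiv I (Suc i) X t))"
      unfolding G by (subst sum.atMost_Suc_shift) simp
    also have "\<dots> \<in> ?W"
      by (intro subspace_sum subspace_scale W combinations_term) auto
    finally show ?thesis .
  qed
  have G2: "G k - F k ** X t - F (Suc r) ** ?x \<in> ?W"
  proof -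
    have "G k - F k ** X t - F (Suc r) ** ?x =
        (\<Sum>i\<le>r. real (k choose Suc (Suc i)) *\<^sub>R (F (r - i) ** nderiv I (Suc (Suc i)) X t))"
      unfolding G r by (subst sum.atMost_Suc_shift, subst sum.atMost_Suc_shift)
        (simp add: matrix_mult_scaleR_right)
    also have "\<dots> \<in> ?W"
      by (intro subspace_sum subspace_scale W combinations_term) auto
    finally show ?thesis .
  qed
  have A_top: "F k + F (Suc r) ** ?a \<in> ?W"
    using nderiv_top_mod_lower[OF A t] by (simp add: F_def[abs_def] r)
  have B_top: "G k + G (Suc r) ** ?b \<in> ?W"
  proof -
    obtain D where "G k + G (Suc r) ** ?b = (\<Sum>p<Suc r. G p ** D p)"
      using nderiv_top_mod_lower[OF B t] by (auto simp: combinations_def G_def r)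
    also have "\<dots> \<in> ?W"
      by (intro subspace_sum W combinations_mult low) auto
    finally show ?thesis .
  qed
  \<comment> \<open>All terms other than the multiples of \<open>A^(k-1)\<close> cancel between the four congruences.\<close>
  have "F (Suc r) ** (X t ** ?b - ?a ** X t + ?x) =
      (G k + G (Suc r) ** ?b) - (G (Suc r) - F (Suc r) ** X t) ** ?b
      - (G k - F k ** X t - F (Suc r) ** ?x) - (F k + F (Suc r) ** ?a) ** X t"
    by (simp add: matrix_mult_add_left matrix_mult_add_right matrix_mult_diff_left
        matrix_mult_diff_right matrix_mul_assoc)
  also have "\<dots> \<in> ?W"
    by (intro subspace_diff W A_top B_top G1 G2 combinations_mult)
  finally have "X t ** ?b - ?a ** X t + ?x = 0"
    using subleading_combination_imp_zero[OF A t] by (simp add: F_def[abs_def] r)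
  then have "real k *\<^sub>R (X t ** coeffs k I B 1 t - coeffs k I A 1 t ** X t + nderiv I 1 X t) = 0"
    by (simp add: matrix_mult_scaleR_left matrix_mult_scaleR_right scaleR_add_right scaleR_diff_right)
  then have "X t ** coeffs k I B 1 t - coeffs k I A 1 t ** X t + nderiv I 1 X t = 0"
    using k by (simp only: scaleR_eq_0_iff) simp
  then show ?thesis by (simp add: algebra_simps)
qed

section \<open>Normal frames and congruence\<close>

lemma schwarzian_normal:
  fixes A :: "real \<Rightarrow> real^'n^'m"
  assumes A: "normal_frame k I A" and t: "t \<in> I"
  shows "schwarzian k I A t = 2 *\<^sub>R coeffs k I A 2 t"
proof -
  have F: "fanning_frame k I A" and P1: "\<And>t. t \<in> I \<Longrightarrow> coeffs k I A 1 t = 0"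
    using A by (auto simp: normal_frame_iff)
  have "smooth_curve I (coeffs k I A 1)"
    by (rule smooth_curve_coeffs[OF F]) (use k in auto)
  then have "nderiv I 1 (coeffs k I A 1) t = nderiv I 1 (\<lambda>t. 0) t"
    by (rule nderiv_cong[symmetric]) (use P1 t in auto)
  then show ?thesis
    using P1[OF t] nderiv_const[OF t, of 1 "0 :: real^'n^'n"]
    by (simp add: schwarzian_def matrix_mult_zero_right)
qed

text \<open>The equation of the gauge becomes \<open>X' = 0\<close>, \<open>X(0) = 1\<close>.\<close>

lemma gauge_sol_normal:
  fixes A :: "real \<Rightarrow> real^'n^'m"
  assumes zero: "0 \<in> I" and A: "normal_frame k I A"
  shows "smooth_curve I (gauge_sol k I A)"
    and "t \<in> I \<Longrightarrow> gauge_sol k I A t = mat 1"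
proof -
  have P1: "coeffs k I A 1 t = 0" if "t \<in> I" for t
    using A that by (auto simp: normal_frame_iff)
  have "invertible (mat 1 :: real^'n^'n)" by (auto simp: invertible_left_inverse)
  then have "is_gauge k I A (\<lambda>t. mat 1)"
    using P1 by (simp add: is_gauge_def smooth_curve_const matrix_mult_zero_right)
  then have X: "is_gauge k I A (gauge_sol k I A)"
    unfolding gauge_sol_def by (rule someI[of "is_gauge k I A"])
  then show "smooth_curve I (gauge_sol k I A)" by (simp add: is_gauge_def)
  have "(gauge_sol k I A has_vector_derivative 0) (at t within I)" if "t \<in> I" for t
    using X P1[OF that] that by (auto simp: is_gauge_def matrix_mult_zero_right)
  then show "gauge_sol k I A t = mat 1" if "t \<in> I"
    using derivative_zero_imp_constant[OF _ zero that, of "gauge_sol k I A"] X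
    by (simp add: is_gauge_def)
qed

text \<open>A constant gauge leaves only the term of \<open>Q\<^sub>j\<^sub>+\<^sub>2\<close> in which it is not differentiated.\<close>

lemma h_inv_normal:
  fixes A :: "real \<Rightarrow> real^'n^'m"
  assumes zero: "0 \<in> I" and A: "normal_frame k I A" and t: "t \<in> I"
  shows "h_inv k I j A t = coeffs k I A (j + 2) t"
proof -
  note X = gauge_sol_normal[OF zero A]
  have inv1: "matrix_inv (mat 1) = (mat 1 :: real^'n^'n)"
    using matrix_inv_left[of "mat 1 :: real^'n^'n"] by (auto simp: invertible_left_inverse)
  have dX: "nderiv I m (gauge_sol k I A) t = (if m = 0 then mat 1 else 0)" for m
    using nderiv_cong[OF X(1), of "\<lambda>t. mat 1" t m] X(2) t nderiv_const[OF t, of m "mat 1 :: real^'n^'n"]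
    by simp
  have "Q_coeff k I j A t = (\<Sum>i=0..j. if i = j then coeffs k I A j t else 0)" for j
    unfolding Q_coeff_def
    by (intro sum.cong) (auto simp: dX X(2)[OF t] inv1 matrix_mult_zero_left)
  then show ?thesis by (simp add: h_inv_def X(2)[OF t] inv1)
qed

lemma normal_frame_exists:
  fixes A :: "real \<Rightarrow> real^'n^'m"
  assumes zero: "0 \<in> I" and A: "fanning_frame k I A" and l: "spans_curve I A l"
  shows "\<exists>B :: real \<Rightarrow> real^'n^'m. normal_frame k I B \<and> spans_curve I B l"
proof -
  have "smooth_curve I (coeffs k I A 1)"
    by (rule smooth_curve_coeffs[OF A]) (use k in auto)
  then obtain X :: "real \<Rightarrow> real^'n^'n" where X: "smooth_curve I X" "\<And>t. t \<in> I \<Longrightarrow> invertible (X t)"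
    "\<And>t. t \<in> I \<Longrightarrow> (X has_vector_derivative coeffs k I A 1 t ** X t) (at t within I)"
    using matrix_ode_solution_exists[OF zero] by blast
  let ?B = "\<lambda>t. A t ** X t"
  have B: "fanning_frame k I ?B" by (rule fanning_frame_right_mult[OF A X(1,2)])
  have "coeffs k I ?B 1 t = 0" if t: "t \<in> I" for t
  proof -
    have "nderiv I 1 X t = coeffs k I A 1 t ** X t"
      using X(3)[OF t] at_within_nontrivial[OF t] by (simp add: vector_derivative_within)
    then have "X t ** coeffs k I ?B 1 t = 0"
      using coeffs_1_right_mult[OF A B X(1) _ t] by simp
    then have "matrix_inv (X t) ** (X t ** coeffs k I ?B 1 t) = 0"
      by (simp add: matrix_mult_zero_right)
    then show ?thesis by (simp add: matrix_mul_assoc matrix_inv_left X(2)[OF t])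
  qed
  moreover have "range ((*v) (?B t)) = range ((*v) (A t))" if t: "t \<in> I" for t
  proof -
    have 1: "A t *v w = ?B t *v (matrix_inv (X t) *v w)" for w
      by (simp add: matrix_vector_mul_assoc matrix_mul_assoc[symmetric] matrix_inv_right X(2)[OF t])
    have 2: "?B t *v w = A t *v (X t *v w)" for w by (simp add: matrix_vector_mul_assoc)
    show ?thesis
      by (intro equalityI image_subsetI) (rule image_eqI[where f = "(*v) (A t)", OF 2 UNIV_I],
        rule image_eqI[where f = "(*v) (?B t)", OF 1 UNIV_I])
  qed
  ultimately show ?thesis
    using B l by (intro exI[of _ ?B]) (auto simp: normal_frame_iff spans_curve_def span_columns_eq_range)
qed

text \<open>Pointwise the ratio exists because both frames span the same space. It is smooth because it is
also the first block of the expansion of \<open>B\<close> in the jet of \<open>A\<close>.\<close>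

lemma frame_ratio_exists:
  fixes A B :: "real \<Rightarrow> real^'n^'m"
  assumes A: "fanning_frame k I A" and B: "fanning_frame k I B"
    and span: "\<And>t. t \<in> I \<Longrightarrow> span (columns (A t)) = span (columns (B t))"
  shows "\<exists>X. smooth_curve I X \<and> (\<forall>t\<in>I. invertible (X t) \<and> B t = A t ** X t)"
proof -
  have "k > 0" using k by simp
  have factor: "\<exists>Z. R = F ** Z" if "span (columns R) \<subseteq> span (columns F)" for R F :: "real^'n^'m"
  proof -
    have "columns R \<subseteq> span (\<Union>p<(1::nat). columns F)"
      using that span_superset[of "columns R"] by (simp add: lessThan_Suc)
    then have "R \<in> combinations (\<lambda>_. F) 1"
      by (simp only: columns_subset_span_iff_combinations)
    then show ?thesis by (auto simp: combinations_def)
  qed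
  have single: "(\<Sum>p<k. nderiv I p A t ** (if p = 0 then Z else 0)) = A t ** Z" for t and Z :: "real^'n^'n"
  proof -
    have "(\<Sum>p<k. nderiv I p A t ** (if p = 0 then Z else 0)) = (\<Sum>p<k. if p = 0 then A t ** Z else 0)"
      by (intro sum.cong) (auto simp: matrix_mult_zero_right)
    then show ?thesis using \<open>k > 0\<close> by simp
  qed
  obtain D :: "nat \<Rightarrow> real \<Rightarrow> real^'n^'n" where D: "\<And>p. smooth_curve I (D p)"
    "\<And>t. t \<in> I \<Longrightarrow> B t = (\<Sum>p<k. nderiv I p A t ** D p t)"
    using jet_expansion_exists[OF A smooth_curve_frame[OF B]] by blast
  have "invertible (D 0 t) \<and> B t = A t ** D 0 t" if t: "t \<in> I" for t
  proof -
    obtain Z where Z: "B t = A t ** Z" using factor span[OF t] by blast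
    obtain Y where Y: "A t = B t ** Y" using factor span[OF t] by blast
    have "D 0 t = (if (0::nat) = 0 then Z else 0)"
      by (rule jet_expansion_unique[OF A t _ \<open>k > 0\<close>]) (simp only: single D(2)[OF t, symmetric] Z)
    then have Z0: "D 0 t = Z" by simp
    have "A t ** (Z ** Y) = A t ** mat 1" using Y Z by (simp add: matrix_mul_assoc)
    then have "(if (0::nat) = 0 then Z ** Y else 0) = (if (0::nat) = 0 then mat 1 else 0)"
      by (intro jet_expansion_unique[OF A t _ \<open>k > 0\<close>, of "\<lambda>p. if p = 0 then Z ** Y else 0"
            "\<lambda>p. if p = 0 then mat 1 else 0"]) (simp only: single)
    then show ?thesis using Z by (auto simp: Z0 invertible_right_inverse)
  qed
  with D(1) show ?thesis by blast
qed

lemma normal_frame_ratio_constant: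
  fixes A B :: "real \<Rightarrow> real^'n^'m"
  assumes zero: "0 \<in> I" and A: "normal_frame k I A" and B: "normal_frame k I B"
    and span: "\<And>t. t \<in> I \<Longrightarrow> span (columns (A t)) = span (columns (B t))"
  shows "\<exists>X. invertible X \<and> (\<forall>t\<in>I. B t = A t ** X)"
proof -
  have FA: "fanning_frame k I A" and PA: "\<And>t. t \<in> I \<Longrightarrow> coeffs k I A 1 t = 0"
    and FB: "fanning_frame k I B" and PB: "\<And>t. t \<in> I \<Longrightarrow> coeffs k I B 1 t = 0"
    using A B by (auto simp: normal_frame_iff)
  obtain X where X: "smooth_curve I X" "\<And>t. t \<in> I \<Longrightarrow> invertible (X t)"
    "\<And>t. t \<in> I \<Longrightarrow> B t = A t ** X t"
    using frame_ratio_exists[OF FA FB span] by blast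
  have dX: "(X has_vector_derivative 0) (at t within I)" if t: "t \<in> I" for t
  proof -
    have "nderiv I 1 X t = 0"
      using coeffs_1_right_mult[OF FA FB X(1,3) t] PA[OF t] PB[OF t]
      by (simp only: matrix_mult_zero_left matrix_mult_zero_right) simp
    then show ?thesis using smooth_curve_has_derivative[OF X(1) t] by simp
  qed
  have "B t = A t ** X 0" if "t \<in> I" for t
    using X(3)[OF that] derivative_zero_imp_constant[OF dX zero that] by simp
  with X(2)[OF zero] show ?thesis by blast
qed

text \<open>Let \<open>T(t)\<close> take the jet of \<open>A\<close> to the jet of \<open>B\<close>, that is, \<open>T A^(p) = B^(p)\<close> for \<open>p < k\<close>. Since both
frames solve the same equation, this also holds for \<open>p = k\<close>. Differentiating it for \<open>p < k\<close> leaves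
\<open>T' A^(p) = 0\<close>, so \<open>T' = 0\<close> because the jet of \<open>A\<close> is invertible.\<close>

lemma equal_coeffs_imp_congruent_frames:
  fixes A B :: "real \<Rightarrow> real^'n^'m"
  assumes zero: "0 \<in> I" and A: "fanning_frame k I A" and B: "fanning_frame k I B"
    and eq: "\<And>i t. i \<in> {1..k} \<Longrightarrow> t \<in> I \<Longrightarrow> coeffs k I A i t = coeffs k I B i t"
  shows "\<exists>T. invertible T \<and> (\<forall>t\<in>I. B t = T ** A t)"
proof -
  let ?JA = "jet_matrix k I A" and ?JB = "jet_matrix k I B"
  have inv: "invertible (?JA t)" "invertible (?JB t)" if "t \<in> I" for t
    using A B that by (simp_all add: fanning_frame_def)
  define T where "T t = ?JB t ** matrix_inv (?JA t)" for t
  have T: "smooth_curve I T"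
    unfolding T_def
    by (intro smooth_curve_matrix_mult smooth_curve_matrix_inv smooth_curve_jet_matrix inv
        smooth_curve_frame[OF A] smooth_curve_frame[OF B])
  have TJ: "T t ** ?JA t = ?JB t" if "t \<in> I" for t
    by (simp add: T_def matrix_mul_assoc[symmetric] matrix_inv_left inv that)
  have low: "T t ** nderiv I p A t = nderiv I p B t" if "p < k" "t \<in> I" for p t
    using TJ[OF that(2)] that(1)
    by (simp add: jet_matrix_eq_block_row mult_block_row block_row_eq_iff[OF card])
  \<comment> \<open>Here the equality of the coefficients enters.\<close>
  have top: "T t ** nderiv I k A t = nderiv I k B t" if t: "t \<in> I" for t
  proof -
    have "T t ** nderiv I k A t = (\<Sum>p<k. T t ** nderiv I p A t ** top_coeff k (\<lambda>i. coeffs k I A i t) p)"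
      unfolding nderiv_top_expansion[OF A t] by (simp add: matrix_mult_sum_right matrix_mul_assoc)
    also have "\<dots> = (\<Sum>p<k. nderiv I p B t ** top_coeff k (\<lambda>i. coeffs k I B i t) p)"
      by (intro sum.cong) (auto simp: low t top_coeff_def eq)
    also have "\<dots> = nderiv I k B t" by (rule nderiv_top_expansion[OF B t, symmetric])
    finally show ?thesis .
  qed
  have all: "T t ** nderiv I p A t = nderiv I p B t" if "p \<le> k" "t \<in> I" for p t
    using that low top by (cases "p = k") auto
  have dT: "(T has_vector_derivative 0) (at t within I)" if t: "t \<in> I" for t
  proof -
    have "nderiv I 1 T t ** nderiv I p A t = 0" if p: "p < k" for p
    proof -
      have "((\<lambda>t. T t ** nderiv I p A t) has_vector_derivative
          (T t ** nderiv I (Suc p) A t + nderiv I 1 T t ** nderiv I p A t)) (at t within I)"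
        by (intro matrix_mult_has_vector_derivative smooth_curve_has_derivative[OF T t]
            nderiv_has_vector_derivative[OF smooth_curve_frame[OF A] t])
      moreover have "((\<lambda>t. T t ** nderiv I p A t) has_vector_derivative nderiv I (Suc p) B t) (at t within I)"
        by (rule has_vector_derivative_transform[OF t _ nderiv_has_vector_derivative[OF smooth_curve_frame[OF B] t]])
          (use low p in auto)
      ultimately have "T t ** nderiv I (Suc p) A t + nderiv I 1 T t ** nderiv I p A t = nderiv I (Suc p) B t"
        by (rule vector_derivative_unique_within[OF at_within_nontrivial[OF t]])
      then show ?thesis using all[of "Suc p" t] p t by simp
    qed
    then have "nderiv I 1 T t ** ?JA t = 0 ** ?JA t"
      by (simp add: jet_matrix_eq_block_row mult_block_row block_row_eq_iff[OF card] matrix_mult_zero_left)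
    then have "nderiv I 1 T t ** ?JA t ** matrix_inv (?JA t) = 0"
      by (simp add: matrix_mult_zero_left)
    then have "nderiv I 1 T t = 0"
      by (simp add: matrix_mul_assoc[symmetric] matrix_inv_right inv t)
    then show ?thesis using smooth_curve_has_derivative[OF T t] by simp
  qed
  have const: "T t = T 0" if "t \<in> I" for t
    using derivative_zero_imp_constant[OF dT zero that] .
  have "B t = T 0 ** A t" if "t \<in> I" for t
    using low[of 0 t] k that const[OF that] by simp
  moreover have "invertible (T 0)"
  proof -
    have "invertible (matrix_inv (?JA 0))"
      using matrix_inv_right[OF inv(1)[OF zero]] by (auto simp: invertible_left_inverse)
    then show ?thesis unfolding T_def by (intro invertible_mult inv zero)
  qed
  ultimately show ?thesis by blast
qed

text \<open>\<open>T A\<close> is a normal frame of the second curve, so \<open>B\<close> is a constant multiple of it.\<close>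

lemma congruent_imp_coeffs_conjugate:
  fixes A B :: "real \<Rightarrow> real^'n^'m"
  assumes zero: "0 \<in> I" and A: "normal_frame k I A" "spans_curve I A l"
    and B: "normal_frame k I B" "spans_curve I B l'" and cong: "congruent_curves I l l'"
  shows "\<exists>X. invertible X \<and> (\<forall>t\<in>I. \<forall>i\<in>{1..k}.
    coeffs k I B i t = matrix_inv X ** coeffs k I A i t ** X)"
proof -
  obtain T :: "real^'m^'m" where T: "invertible T" "\<And>t. t \<in> I \<Longrightarrow> (\<lambda>v. T *v v) ` l t = l' t"
    using cong by (auto simp: congruent_curves_def)
  have FA: "fanning_frame k I A" and PA: "\<And>t. t \<in> I \<Longrightarrow> coeffs k I A 1 t = 0"
    and FB: "fanning_frame k I B"
    using A B by (auto simp: normal_frame_iff)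
  let ?A = "\<lambda>t. T ** A t"
  have FTA: "fanning_frame k I ?A" by (rule fanning_frame_left_mult[OF FA T(1)])
  have inv1: "invertible (mat 1 :: real^'n^'n)" by (auto simp: invertible_left_inverse)
  have "coeffs k I ?A 1 t = matrix_inv (mat 1) ** coeffs k I A 1 t ** mat 1" if "t \<in> I" for t
    by (rule coeffs_change_constant[OF FA FTA inv1 _ that]) (use k in auto)
  then have NTA: "normal_frame k I ?A"
    using FTA PA by (simp add: normal_frame_iff matrix_mult_zero_right matrix_mult_zero_left)
  have "span (columns (?A t)) = span (columns (B t))" if t: "t \<in> I" for t
  proof -
    have "span (columns (?A t)) = (\<lambda>v. T *v v) ` span (columns (A t))"
      by (simp add: span_columns_eq_range image_image matrix_vector_mul_assoc)
    then show ?thesis using A(2) B(2) T(2)[OF t] t by (simp add: spans_curve_def)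
  qed
  then obtain X where X: "invertible X" "\<And>t. t \<in> I \<Longrightarrow> B t = T ** A t ** X"
    using normal_frame_ratio_constant[OF zero NTA B(1)] by blast
  then show ?thesis
    using coeffs_change_constant[OF FA FB X] by blast
qed

lemma coeffs_conjugate_imp_congruent:
  fixes A B :: "real \<Rightarrow> real^'n^'m"
  assumes zero: "0 \<in> I" and A: "fanning_frame k I A" "spans_curve I A l"
    and B: "fanning_frame k I B" "spans_curve I B l'" and X: "invertible X"
    and eq: "\<And>i t. i \<in> {1..k} \<Longrightarrow> t \<in> I \<Longrightarrow>
      coeffs k I B i t = matrix_inv X ** coeffs k I A i t ** X"
  shows "congruent_curves I l l'"
proof -
  let ?A = "\<lambda>t. A t ** X"
  have FAX: "fanning_frame k I ?A"
    by (rule fanning_frame_right_mult[OF A(1) smooth_curve_const]) (rule X)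
  have "coeffs k I ?A i t = coeffs k I B i t" if "i \<in> {1..k}" "t \<in> I" for i t
    using coeffs_change_constant[OF A(1) FAX X, of "mat 1" t i] that eq by simp
  then obtain T where T: "invertible T" "\<And>t. t \<in> I \<Longrightarrow> B t = T ** (A t ** X)"
    using equal_coeffs_imp_congruent_frames[OF zero FAX B(1)] by blast
  have "(\<lambda>v. T *v v) ` l t = l' t" if t: "t \<in> I" for t
  proof -
    have "range ((*v) (A t)) = range (\<lambda>w. A t *v (X *v w))"
    proof -
      have "surj ((*v) X)"
        using X by (simp add: invertible_right_inverse matrix_right_invertible_surjective)
      moreover have "range (\<lambda>w. A t *v (X *v w)) = (*v) (A t) ` range ((*v) X)"
        by (simp add: image_image)
      ultimately show ?thesis by simp
    qed
    then have "(\<lambda>v. T *v v) ` range ((*v) (A t)) = range ((*v) (B t))"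
      by (simp add: image_image T(2)[OF t] matrix_vector_mul_assoc matrix_mul_assoc)
    then show ?thesis using A(2) B(2) t by (simp add: spans_curve_def span_columns_eq_range)
  qed
  with T(1) show ?thesis by (auto simp: congruent_curves_def)
qed

end

end

end

theorem theorem2p4:
  fixes k :: nat and I :: "real set" and l l' :: "real \<Rightarrow> (real^'m) set"
  assumes "k \<ge> 2"
    and "CARD('m) = k * CARD('n::finite)"
    and "is_interval I" and "0 \<in> I" and "interior I \<noteq> {}"
    and "fanning_curve k TYPE('n) I l"
    and "fanning_curve k TYPE('n) I l'"
  shows "congruent_curves I l l' \<longleftrightarrow>
    (\<forall>A B :: real \<Rightarrow> real^'n^'m.
       normal_frame k I A \<and> spans_curve I A l \<and> normal_frame k I B \<and> spans_curve I B l' \<longrightarrow>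
       (\<exists>X :: real^'n^'n. invertible X \<and>
          (\<forall>t\<in>I. schwarzian k I B t = matrix_inv X ** schwarzian k I A t ** X \<and>
                 (\<forall>j\<in>{1..k - 2}. h_inv k I j B t = matrix_inv X ** h_inv k I j A t ** X))))"
proof -
  interpret curve_domain I using assms(3,5) by unfold_locales
  note card = assms(2) and k = assms(1) and zero = assms(4)
  note sch = schwarzian_normal[OF card k] and h = h_inv_normal[OF card k zero]
  show ?thesis
  proof (intro iffI allI impI)
    fix A B :: "real \<Rightarrow> real^'n^'m"
    assume cong: "congruent_curves I l l'"
      and *: "normal_frame k I A \<and> spans_curve I A l \<and> normal_frame k I B \<and> spans_curve I B l'"
    then have A: "normal_frame k I A" "spans_curve I A l" and B: "normal_frame k I B" "spans_curve I B l'"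
      by auto
    obtain X :: "real^'n^'n" where X: "invertible X"
      "\<And>t i. t \<in> I \<Longrightarrow> i \<in> {1..k} \<Longrightarrow> coeffs k I B i t = matrix_inv X ** coeffs k I A i t ** X"
      using congruent_imp_coeffs_conjugate[OF card k zero A B cong] by blast
    have "schwarzian k I B t = matrix_inv X ** schwarzian k I A t ** X" if "t \<in> I" for t
      using X(2)[OF that, of 2] k that
      by (simp add: sch[OF A(1)] sch[OF B(1)] matrix_mult_scaleR_left matrix_mult_scaleR_right)
    moreover have "h_inv k I j B t = matrix_inv X ** h_inv k I j A t ** X"
      if "t \<in> I" "j \<in> {1..k - 2}" for t j
    proof -
      have "j + 2 \<in> {1..k}" using that(2) k by auto
      from X(2)[OF that(1) this] show ?thesis by (simp add: h[OF A(1) that(1)] h[OF B(1) that(1)])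
    qed
    ultimately show "\<exists>X :: real^'n^'n. invertible X \<and>
        (\<forall>t\<in>I. schwarzian k I B t = matrix_inv X ** schwarzian k I A t ** X \<and>
               (\<forall>j\<in>{1..k - 2}. h_inv k I j B t = matrix_inv X ** h_inv k I j A t ** X))"
      using X(1) by blast
  next
    assume *: "\<forall>A B :: real \<Rightarrow> real^'n^'m.
       normal_frame k I A \<and> spans_curve I A l \<and> normal_frame k I B \<and> spans_curve I B l' \<longrightarrow>
       (\<exists>X :: real^'n^'n. invertible X \<and>
          (\<forall>t\<in>I. schwarzian k I B t = matrix_inv X ** schwarzian k I A t ** X \<and>
                 (\<forall>j\<in>{1..k - 2}. h_inv k I j B t = matrix_inv X ** h_inv k I j A t ** X)))"
    obtain A :: "real \<Rightarrow> real^'n^'m" where A: "normal_frame k I A" "spans_curve I A l"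
      using assms(6) normal_frame_exists[OF card k zero] unfolding fanning_curve_def by blast
    obtain B :: "real \<Rightarrow> real^'n^'m" where B: "normal_frame k I B" "spans_curve I B l'"
      using assms(7) normal_frame_exists[OF card k zero] unfolding fanning_curve_def by blast
    have "\<exists>X :: real^'n^'n. invertible X \<and>
        (\<forall>t\<in>I. schwarzian k I B t = matrix_inv X ** schwarzian k I A t ** X \<and>
               (\<forall>j\<in>{1..k - 2}. h_inv k I j B t = matrix_inv X ** h_inv k I j A t ** X))"
      by (rule *[rule_format]) (intro conjI A B)
    then obtain X :: "real^'n^'n" where X: "invertible X"
      and sX: "\<And>t. t \<in> I \<Longrightarrow> schwarzian k I B t = matrix_inv X ** schwarzian k I A t ** X"
      and hX: "\<And>t j. t \<in> I \<Longrightarrow> j \<in> {1..k - 2} \<Longrightarrow>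
        h_inv k I j B t = matrix_inv X ** h_inv k I j A t ** X"
      by blast
    note norm = normal_frame_iff[OF card k, THEN iffD1]
    have eq: "coeffs k I B i t = matrix_inv X ** coeffs k I A i t ** X"
      if i: "i \<in> {1..k}" and t: "t \<in> I" for i t
    proof -
      have "i = 1 \<or> i = 2 \<or> i = (i - 2) + 2 \<and> i - 2 \<in> {1..k - 2}" using i by auto
      then consider "i = 1" | "i = 2" | j where "i = j + 2" "j \<in> {1..k - 2}" by blast
      then show ?thesis
      proof cases
        case 1
        then show ?thesis using norm[OF A(1)] norm[OF B(1)] t
          by (simp add: matrix_mult_zero_left matrix_mult_zero_right)
      next
        case 2
        then show ?thesis using sX[OF t]
          by (simp add: sch[OF A(1) t] sch[OF B(1) t] matrix_mult_scaleR_left matrix_mult_scaleR_right)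
      next
        case 3
        then show ?thesis using hX[OF t 3(2)] by (simp add: h[OF A(1) t] h[OF B(1) t])
      qed
    qed
    show "congruent_curves I l l'"
      by (rule coeffs_conjugate_imp_congruent[OF card k zero _ A(2) _ B(2) X eq])
        (use norm[OF A(1)] norm[OF B(1)] in auto)
  qed
qed

end
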